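(* Let $\mathcal{A}$ be a Banach algebra and let $\sigma\in Hom(\mathcal{A})$. If $\mathcal{A}$ is $\sigma$-biprojective, then $\mathcal{A}$ is $\sigma$-biflat.
   Context: $Hom(\mathcal{A})$ is the set of all continuous algebra homomorphisms $\mathcal{A}\to\mathcal{A}$. The projective tensor product $\mathcal{A}\widehat{\otimes}\mathcal{A}$ is a Banach $\mathcal{A}$-bimodule via $a\cdot(b\otimes c)=ab\otimes c$ and $(b\otimes c)\cdot a=b\otimes ca$. The diagonal operator is $\pi:\mathcal{A}\widehat{\otimes}\mathcal{A}\to\mathcal{A}$, $\pi(a\otimes b)=ab$. For a Banach $\mathcal{A}$-bimodule $X$, the dual $X^*$ is a Banach $\mathcal{A}$-bimodule via $\langle a\cdot\lambda,x\rangle=\langle\lambda,x\cdot a\rangle$ and $\langle\lambda\cdot a,x\rangle=\langle\lambda,a\cdot x\rangle$. For Banach $\mathcal{A}$-bimodules $X,Y$, a bounded linear map $T:X\to Y$ is a $\sigma$-$\mathcal{A}$-bimodule homomorphism if $T(a\cdot x)=\sigma(a)\cdot T(x)$ and $T(x\cdot a)=T(x)\cdot\sigma(a)$ for all $a\in\mathcal{A}$, $x\in X$. $\mathcal{A}$ is $\sigma$-biprojective if there exists a $\sigma$-$\mathcal{A}$-bimodule homomorphism $\rho:\mathcal{A}\to\mathcal{A}\widehat{\otimes}\mathcal{A}$ such that $\pi\circ\rho=\sigma$. $\mathcal{A}$ is $\sigma$-biflat if there exists a bounded linear map $\rho:(\mathcal{A}\widehat{\otimes}\mathcal{A})^*\to\mathcal{A}^*$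 such that $\rho(\sigma(a)\cdot\lambda)=a\cdot\rho(\lambda)$ and $\rho(\lambda\cdot\sigma(a))=\rho(\lambda)\cdot a$ for all $a\in\mathcal{A}$, $\lambda\in(\mathcal{A}\widehat{\otimes}\mathcal{A})^*$, and $\rho\circ\pi^*=\sigma^*$. *)

theory Defs
  imports "HOL-Analysis.Analysis" "HOL-Library.Poly_Mapping"
begin

section \<open>Complex normed spaces and complex Banach algebras\<close>

text \<open>
  Banach spaces and Banach algebras are complex. The real structure of the library classes
  is kept, and complex scalars are added compatibly with it.
\<close>

class complex_vector = real_vector +
  fixes scaleC :: "complex \<Rightarrow> 'a \<Rightarrow> 'a" (infixr "*\<^sub>C" 75)
  assumes scaleC_add_right: "c *\<^sub>C (x + y) = c *\<^sub>C x + c *\<^sub>C y"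
    and scaleC_add_left: "(c + d) *\<^sub>C x = c *\<^sub>C x + d *\<^sub>C x"
    and scaleC_scaleC: "c *\<^sub>C d *\<^sub>C x = (c * d) *\<^sub>C x"
    and scaleR_scaleC: "r *\<^sub>R x = complex_of_real r *\<^sub>C x"

class complex_normed_vector = complex_vector + real_normed_vector +
  assumes norm_scaleC: "norm (c *\<^sub>C x) = cmod c * norm x"

class complex_banach = complex_normed_vector + banach

text \<open>The algebra need not have a unit, and the zero algebra is allowed.\<close>

class complex_banach_algebra = complex_banach + real_normed_algebra +
  assumes mult_scaleC_left: "(c *\<^sub>C x) * y = c *\<^sub>C (x * y)"
    and mult_scaleC_right: "x * (c *\<^sub>C y) = c *\<^sub>C (x * y)"

lemma scaleC_one [simp]: "1 *\<^sub>C x = (x :: 'a :: complex_vector)"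
  using scaleR_scaleC[of 1 x] by simp

interpretation complex_vector: vector_space "scaleC :: complex \<Rightarrow> 'a \<Rightarrow> 'a::complex_vector"
  by unfold_locales (simp_all add: scaleC_add_right scaleC_add_left scaleC_scaleC)

instantiation complex :: complex_banach_algebra
begin
definition scaleC_complex :: "complex \<Rightarrow> complex \<Rightarrow> complex" where
  "scaleC_complex c x = c * x"
instance
  by intro_classes
    (simp_all add: scaleC_complex_def algebra_simps norm_mult scaleR_conv_of_real)
end

definition cbounded_linear ::
  "('a::complex_normed_vector \<Rightarrow> 'b::complex_normed_vector) \<Rightarrow> bool" where
  "cbounded_linear f \<longleftrightarrow> bounded_linear f \<and> (\<forall>c x. f (c *\<^sub>C x) = c *\<^sub>C f x)"

definition cbounded_bilinear ::
  "('a::complex_normed_vector \<Rightarrow> 'b::complex_normed_vector \<Rightarrow> 'c::complex_normed_vector) \<Rightarrow> bool"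
  where
  "cbounded_bilinear B \<longleftrightarrow> bounded_bilinear B \<and>
     (\<forall>c x y. B (c *\<^sub>C x) y = c *\<^sub>C B x y) \<and> (\<forall>c x y. B x (c *\<^sub>C y) = c *\<^sub>C B x y)"

lemma cbounded_linear_compose:
  "cbounded_linear f \<Longrightarrow> cbounded_linear g \<Longrightarrow> cbounded_linear (\<lambda>x. f (g x))"
  unfolding cbounded_linear_def by (auto intro: bounded_linear_compose)

lemma cbounded_bilinear_left: "cbounded_bilinear B \<Longrightarrow> cbounded_linear (\<lambda>x. B x y)"
  unfolding cbounded_linear_def cbounded_bilinear_def
  by (auto intro: bounded_bilinear.bounded_linear_left)

lemma cbounded_bilinear_right: "cbounded_bilinear B \<Longrightarrow> cbounded_linear (\<lambda>y. B x y)"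
  unfolding cbounded_linear_def cbounded_bilinear_def
  by (auto intro: bounded_bilinear.bounded_linear_right)

lemma cbounded_bilinear_mult:
  "cbounded_bilinear ((*) :: 'a::complex_banach_algebra \<Rightarrow> 'a \<Rightarrow> 'a)"
  unfolding cbounded_bilinear_def
  by (simp add: bounded_bilinear_mult mult_scaleC_left mult_scaleC_right)


section \<open>The algebraic tensor product\<close>

instantiation poly_mapping :: (type, complex_vector) complex_vector
begin
lift_definition scaleC_poly_mapping ::
  "complex \<Rightarrow> ('a \<Rightarrow>\<^sub>0 'b) \<Rightarrow> 'a \<Rightarrow>\<^sub>0 'b" is "\<lambda>c f k. c *\<^sub>C f k"
  by (erule finite_subset[rotated]) auto
definition scaleR_poly_mapping :: "real \<Rightarrow> ('a \<Rightarrow>\<^sub>0 'b) \<Rightarrow> 'a \<Rightarrow>\<^sub>0 'b" where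
  "scaleR_poly_mapping r f = complex_of_real r *\<^sub>C f"
instance
  by intro_classes
    (simp_all add: scaleR_poly_mapping_def,
     (transfer, simp add: fun_eq_iff scaleC_add_right scaleC_add_left scaleC_scaleC)+)
end

lemma lookup_scaleC [simp]: "Poly_Mapping.lookup (c *\<^sub>C f) k = c *\<^sub>C Poly_Mapping.lookup f k"
  by transfer simp

text \<open>
  The algebraic tensor product over the complex numbers: the free complex vector space on
  \<^term>\<open>UNIV \<times> UNIV\<close> modulo the span of the bilinearity relations.
\<close>

abbreviation free_gen :: "'a \<Rightarrow> 'b \<Rightarrow> ('a \<times> 'b) \<Rightarrow>\<^sub>0 complex" where
  "free_gen a b \<equiv> Poly_Mapping.single (a, b) 1"

definition bilinear_relations ::
  "(('a::complex_vector \<times> 'b::complex_vector) \<Rightarrow>\<^sub>0 complex) set" where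
  "bilinear_relations =
     {free_gen (a + a') b - free_gen a b - free_gen a' b | a a' b. True} \<union>
     {free_gen a (b + b') - free_gen a b - free_gen a b' | a b b'. True} \<union>
     {free_gen (c *\<^sub>C a) b - c *\<^sub>C free_gen a b | a b c. True} \<union>
     {free_gen a (c *\<^sub>C b) - c *\<^sub>C free_gen a b | a b c. True}"

definition tensor_null ::
  "(('a::complex_vector \<times> 'b::complex_vector) \<Rightarrow>\<^sub>0 complex) set" where
  "tensor_null = complex_vector.span bilinear_relations"

lemma tensor_null_add: "u \<in> tensor_null \<Longrightarrow> v \<in> tensor_null \<Longrightarrow> u + v \<in> tensor_null"
  unfolding tensor_null_def by (rule complex_vector.span_add)
lemma tensor_null_diff: "u \<in> tensor_null \<Longrightarrow> v \<in> tensor_null \<Longrightarrow> u - v \<in> tensor_null"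
  unfolding tensor_null_def by (rule complex_vector.span_diff)
lemma tensor_null_neg: "u \<in> tensor_null \<Longrightarrow> - u \<in> tensor_null"
  unfolding tensor_null_def by (rule complex_vector.span_neg)
lemma tensor_null_scaleC: "u \<in> tensor_null \<Longrightarrow> c *\<^sub>C u \<in> tensor_null"
  unfolding tensor_null_def by (rule complex_vector.span_scale)
lemma tensor_null_zero: "0 \<in> tensor_null"
  unfolding tensor_null_def by (rule complex_vector.span_zero)

lemma tensor_null_diff_diff:
  assumes "u - u' \<in> tensor_null" "v - v' \<in> tensor_null"
  shows "u - v - (u' - v') \<in> tensor_null"
proof -
  have "u - v - (u' - v') = (u - u') - (v - v')" by (simp add: algebra_simps)
  then show ?thesis using tensor_null_diff[OF assms] by metis
qed

quotient_type (overloaded) ('a, 'b) atensor =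
  "(('a::complex_vector \<times> 'b::complex_vector) \<Rightarrow>\<^sub>0 complex)" /
  "\<lambda>u v. u - v \<in> tensor_null"
proof (rule equivpI)
  show "reflp (\<lambda>u v :: ('a \<times> 'b) \<Rightarrow>\<^sub>0 complex. u - v \<in> tensor_null)"
    by (simp add: reflp_def tensor_null_zero)
  show "symp (\<lambda>u v :: ('a \<times> 'b) \<Rightarrow>\<^sub>0 complex. u - v \<in> tensor_null)"
    unfolding symp_def using tensor_null_neg by fastforce
  show "transp (\<lambda>u v :: ('a \<times> 'b) \<Rightarrow>\<^sub>0 complex. u - v \<in> tensor_null)"
    unfolding transp_def using tensor_null_add by fastforce
qed

instantiation atensor :: (complex_vector, complex_vector) complex_vector
begin
lift_definition zero_atensor :: "('a, 'b) atensor" is 0 .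
lift_definition plus_atensor :: "('a, 'b) atensor \<Rightarrow> ('a, 'b) atensor \<Rightarrow> ('a, 'b) atensor" is "(+)"
  by (simp only: add_diff_add tensor_null_add)
lift_definition minus_atensor :: "('a, 'b) atensor \<Rightarrow> ('a, 'b) atensor \<Rightarrow> ('a, 'b) atensor" is "(-)"
  by (simp add: tensor_null_diff_diff)
lift_definition uminus_atensor :: "('a, 'b) atensor \<Rightarrow> ('a, 'b) atensor" is uminus
  by (simp only: minus_diff_minus tensor_null_neg)
lift_definition scaleC_atensor :: "complex \<Rightarrow> ('a, 'b) atensor \<Rightarrow> ('a, 'b) atensor" is scaleC
  by (simp only: complex_vector.scale_right_diff_distrib[symmetric] tensor_null_scaleC)
definition scaleR_atensor :: "real \<Rightarrow> ('a, 'b) atensor \<Rightarrow> ('a, 'b) atensor" where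
  "scaleR_atensor r u = complex_of_real r *\<^sub>C u"
instance
proof
  fix u v w :: "('a, 'b) atensor" and c d :: complex and r s :: real
  show a: "c *\<^sub>C (u + v) = c *\<^sub>C u + c *\<^sub>C v" for c and u v :: "('a, 'b) atensor"
    by transfer (simp add: scaleC_add_right tensor_null_zero)
  show b: "(c + d) *\<^sub>C u = c *\<^sub>C u + d *\<^sub>C u" for c d
    by transfer (simp add: scaleC_add_left tensor_null_zero)
  show e: "c *\<^sub>C d *\<^sub>C u = (c * d) *\<^sub>C u" for c d
    by transfer (simp add: scaleC_scaleC tensor_null_zero)
  show f: "r *\<^sub>R u = complex_of_real r *\<^sub>C u" for r and u :: "('a, 'b) atensor"
    by (rule scaleR_atensor_def)
  show "u + v + w = u + (v + w)" by transfer (simp add: add.assoc tensor_null_zero)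
  show "u + v = v + u" by transfer (simp add: add.commute tensor_null_zero)
  show "0 + u = u" by transfer (simp add: tensor_null_zero)
  show "- u + u = 0" by transfer (simp add: tensor_null_zero)
  show "u - v = u + - v" by transfer (simp add: tensor_null_zero)
  show "r *\<^sub>R (u + v) = r *\<^sub>R u + r *\<^sub>R v" by (simp only: f a)
  show "(r + s) *\<^sub>R u = r *\<^sub>R u + s *\<^sub>R u" by (simp only: f b of_real_add)
  show "r *\<^sub>R s *\<^sub>R u = (r * s) *\<^sub>R u" by (simp only: f e of_real_mult)
  show "1 *\<^sub>R u = u" unfolding f of_real_1 by transfer (simp add: tensor_null_zero)
qed
end

lift_definition aten :: "'a::complex_vector \<Rightarrow> 'b::complex_vector \<Rightarrow> ('a, 'b) atensor"
  is free_gen .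

lemma bilinear_relations_null: "u \<in> bilinear_relations \<Longrightarrow> u \<in> tensor_null"
  unfolding tensor_null_def by (rule complex_vector.span_base)

lemma aten_add_left: "aten (a + a') b = aten a b + aten a' b"
  by transfer (rule bilinear_relations_null, unfold bilinear_relations_def diff_diff_add[symmetric], blast)
lemma aten_add_right: "aten a (b + b') = aten a b + aten a b'"
  by transfer (rule bilinear_relations_null, unfold bilinear_relations_def diff_diff_add[symmetric], blast)
lemma aten_scaleC_left: "aten (c *\<^sub>C a) b = c *\<^sub>C aten a b"
  by transfer (rule bilinear_relations_null, unfold bilinear_relations_def, blast)
lemma aten_scaleC_right: "aten a (c *\<^sub>C b) = c *\<^sub>C aten a b"
  by transfer (rule bilinear_relations_null, unfold bilinear_relations_def, blast)

lemma free_decomp: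
  fixes u :: "'i \<Rightarrow>\<^sub>0 complex"
  shows "u = (\<Sum>k\<in>Poly_Mapping.keys u. Poly_Mapping.lookup u k *\<^sub>C Poly_Mapping.single k 1)"
proof (rule poly_mapping_eqI)
  fix j
  have "Poly_Mapping.lookup
      (\<Sum>k\<in>Poly_Mapping.keys u. Poly_Mapping.lookup u k *\<^sub>C Poly_Mapping.single k 1) j =
    (\<Sum>k\<in>Poly_Mapping.keys u. if k = j then Poly_Mapping.lookup u k else 0)"
    unfolding lookup_sum
    by (rule sum.cong) (simp_all add: lookup_single when_def scaleC_complex_def)
  also have "\<dots> = Poly_Mapping.lookup u j"
    by (simp add: in_keys_iff)
  finally show "Poly_Mapping.lookup u j = Poly_Mapping.lookup
      (\<Sum>k\<in>Poly_Mapping.keys u. Poly_Mapping.lookup u k *\<^sub>C Poly_Mapping.single k 1) j" ..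
qed

lemma abs_atensor_sum: "abs_atensor (\<Sum>k\<in>A. f k) = (\<Sum>k\<in>A. abs_atensor (f k))"
proof (induction A rule: infinite_finite_induct)
  case (infinite A)
  show ?case unfolding sum.infinite[OF infinite] zero_atensor_def ..
next
  case empty
  show ?case unfolding sum.empty zero_atensor_def ..
next
  case (insert x F)
  show ?case unfolding sum.insert[OF insert(1,2)] plus_atensor.abs_eq[symmetric] insert(3) ..
qed

lemma atensor_decomp: "\<exists>xs. u = (\<Sum>(a, b)\<leftarrow>xs. aten a b)"
proof -
  obtain f where f: "u = abs_atensor f"
    using Quotient_abs_rep[OF Quotient_atensor, of u, symmetric] by (rule that)
  define c where "c = Poly_Mapping.lookup f"
  obtain ks where ks: "set ks = Poly_Mapping.keys f" "distinct ks"
    using finite_distinct_list[OF finite_keys, of f] by (elim exE conjE) (rule that)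
  have "u = (\<Sum>k\<in>Poly_Mapping.keys f. abs_atensor (c k *\<^sub>C Poly_Mapping.single k 1))"
    
    unfolding c_def f abs_atensor_sum[symmetric] by (rule arg_cong[OF free_decomp])
  also have "\<dots> = (\<Sum>k\<in>Poly_Mapping.keys f. aten (c k *\<^sub>C fst k) (snd k))"

  proof (rule sum.cong)
    fix k assume "k \<in> Poly_Mapping.keys f"
    show "abs_atensor (c k *\<^sub>C Poly_Mapping.single k 1) = aten (c k *\<^sub>C fst k) (snd k)"
      unfolding aten_scaleC_left unfolding aten.abs_eq scaleC_atensor.abs_eq prod.collapse ..
  qed simp
  also have "\<dots> = (\<Sum>(a, b)\<leftarrow>map (\<lambda>k. (c k *\<^sub>C fst k, snd k)) ks. aten a b)"
    using sum.distinct_set_conv_list[OF ks(2), of "\<lambda>k. aten (c k *\<^sub>C fst k) (snd k)"]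
    unfolding ks(1) by (simp add: comp_def)
  finally show ?thesis by blast
qed


lemma atensor_lift_exists:
  fixes B :: "'a::complex_vector \<Rightarrow> 'b::complex_vector \<Rightarrow> 'z::complex_vector"
  assumes add_left: "\<And>a a' b. B (a + a') b = B a b + B a' b"
    and add_right: "\<And>a b b'. B a (b + b') = B a b + B a b'"
    and scale_left: "\<And>c a b. B (c *\<^sub>C a) b = c *\<^sub>C B a b"
    and scale_right: "\<And>c a b. B a (c *\<^sub>C b) = c *\<^sub>C B a b"
  shows "\<exists>T. Vector_Spaces.linear scaleC scaleC T \<and> (\<forall>a b. T (aten a b) = B a b)"
proof -
  define E :: "(('a \<times> 'b) \<Rightarrow>\<^sub>0 complex) \<Rightarrow> 'z" where
    "E f = (\<Sum>k\<in>Poly_Mapping.keys f. Poly_Mapping.lookup f k *\<^sub>C B (fst k) (snd k))" for f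
  have E_super: "E f = (\<Sum>k\<in>S. Poly_Mapping.lookup f k *\<^sub>C B (fst k) (snd k))"
    if "finite S" "Poly_Mapping.keys f \<subseteq> S" for S f
    unfolding E_def using that by (intro sum.mono_neutral_left) (auto simp: in_keys_iff)
  have E_add: "E (f + g) = E f + E g" for f g
  proof -
    let ?S = "Poly_Mapping.keys f \<union> Poly_Mapping.keys g"
    have "E (f + g) = (\<Sum>k\<in>?S. Poly_Mapping.lookup (f + g) k *\<^sub>C B (fst k) (snd k))"
      by (rule E_super) (use Poly_Mapping.keys_add[of f g] in auto)
    also have "\<dots> = (\<Sum>k\<in>?S. Poly_Mapping.lookup f k *\<^sub>C B (fst k) (snd k)) +
        (\<Sum>k\<in>?S. Poly_Mapping.lookup g k *\<^sub>C B (fst k) (snd k))"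
      by (simp add: lookup_add scaleC_add_left sum.distrib)
    also have "\<dots> = E f + E g" by (subst (1 2) E_super[of ?S]) auto
    finally show ?thesis .
  qed
  have E_scale: "E (c *\<^sub>C f) = c *\<^sub>C E f" for c f
  proof -
    have "E (c *\<^sub>C f) = (\<Sum>k\<in>Poly_Mapping.keys f. Poly_Mapping.lookup (c *\<^sub>C f) k *\<^sub>C B (fst k) (snd k))"
      by (rule E_super) (auto simp: in_keys_iff scaleC_complex_def)
    also have "\<dots> = c *\<^sub>C E f"
      by (simp add: E_def scaleC_complex_def complex_vector.scale_sum_right scaleC_scaleC)
    finally show ?thesis .
  qed
  have E_diff: "E (f - g) = E f - E g" for f g
    using E_add[of "f - g" g] by simp
  have E_gen: "E (free_gen a b) = B a b" for a b
    by (simp add: E_def)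
  have E_null: "E f = 0" if "f \<in> tensor_null" for f
  proof -
    have base: "E f = 0" if "f \<in> bilinear_relations" for f
      using that unfolding bilinear_relations_def
      by (auto simp: E_diff E_gen E_scale add_left add_right scale_left scale_right)
    from that have "f \<in> complex_vector.span bilinear_relations" unfolding tensor_null_def .
    then show ?thesis
    proof (induction rule: complex_vector.span_induct_alt)
      case base
      show ?case by (simp add: E_def)
    next
      case (step c x y)
      then show ?case by (simp add: E_add E_scale base)
    qed
  qed
  have E_eq: "E (rep_atensor (abs_atensor f)) = E f" for f
  proof -
    have "f - rep_atensor (abs_atensor f) \<in> tensor_null"
      unfolding atensor.abs_eq_iff[symmetric]
      by (rule Quotient_abs_rep[OF Quotient_atensor, symmetric])
    from E_null[OF this] show ?thesis by (simp add: E_diff)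
  qed
  define T where "T u = E (rep_atensor u)" for u
  have T_abs: "T (abs_atensor f) = E f" for f unfolding T_def by (rule E_eq)
  have abs_rep: "abs_atensor (rep_atensor u) = u" for u :: "('a, 'b) atensor"
    by (rule Quotient_abs_rep[OF Quotient_atensor])
  have T_add: "T (u + v) = T u + T v" for u v
    using T_abs[of "rep_atensor u + rep_atensor v"]
    unfolding plus_atensor.abs_eq[symmetric] abs_rep E_add T_def .
  have T_scale: "T (c *\<^sub>C u) = c *\<^sub>C T u" for c u
    using T_abs[of "c *\<^sub>C rep_atensor u"]
    unfolding scaleC_atensor.abs_eq[symmetric] abs_rep E_scale T_def .
  have "T (aten a b) = B a b" for a b
    unfolding aten.abs_eq T_abs E_gen ..
  moreover have "Vector_Spaces.linear scaleC scaleC T"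
    by unfold_locales (simp_all add: T_add T_scale)
  ultimately show ?thesis by blast
qed


section \<open>The projective norm and the projective tensor product\<close>

definition proj_norm ::
  "('a::complex_normed_vector, 'b::complex_normed_vector) atensor \<Rightarrow> real" where
  "proj_norm u = Inf {(\<Sum>(a, b)\<leftarrow>xs. norm a * norm b) | xs. u = (\<Sum>(a, b)\<leftarrow>xs. aten a b)}"

lemma proj_norm_le:
  assumes "u = (\<Sum>(a, b)\<leftarrow>xs. aten a b)"
  shows "proj_norm u \<le> (\<Sum>(a, b)\<leftarrow>xs. norm a * norm b)"
  unfolding proj_norm_def
proof (rule cInf_lower)
  show "bdd_below {(\<Sum>(a, b)\<leftarrow>xs. norm a * norm b) |xs. u = (\<Sum>(a, b)\<leftarrow>xs. aten a b)}"
    by (rule bdd_belowI[of _ 0]) (auto intro!: sum_list_nonneg)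
qed (use assms in blast)

lemma proj_norm_approx:
  assumes "e > 0"
  obtains xs where "u = (\<Sum>(a, b)\<leftarrow>xs. aten a b)"
    and "(\<Sum>(a, b)\<leftarrow>xs. norm a * norm b) < proj_norm u + e"
proof -
  let ?S = "{(\<Sum>(a, b)\<leftarrow>xs. norm a * norm b) |xs. u = (\<Sum>(a, b)\<leftarrow>xs. aten a b)}"
  have "?S \<noteq> {}" using atensor_decomp[of u] by blast
  moreover have "Inf ?S < proj_norm u + e" using assms by (simp add: proj_norm_def)
  ultimately obtain s where "s \<in> ?S" "s < proj_norm u + e"
    by (rule cInf_lessD[THEN bexE])
  then show ?thesis by (auto intro: that)
qed

lemma proj_norm_nonneg: "proj_norm u \<ge> 0"
  unfolding proj_norm_def
  by (rule cInf_greatest) (use atensor_decomp[of u] in \<open>auto intro!: sum_list_nonneg\<close>)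

lemma proj_norm_zero [simp]:
  "proj_norm (0 :: ('a::complex_normed_vector, 'b::complex_normed_vector) atensor) = 0"
  using proj_norm_le[of "0 :: ('a, 'b) atensor" "[]"] proj_norm_nonneg[of "0 :: ('a, 'b) atensor"]
  by simp

lemma proj_norm_aten: "proj_norm (aten a b) \<le> norm a * norm b"
  using proj_norm_le[of "aten a b" "[(a, b)]"] by simp

lemma proj_norm_triangle: "proj_norm (u + v) \<le> proj_norm u + proj_norm v"
proof (rule field_le_epsilon)
  fix e :: real assume "e > 0"
  then have "e / 2 > 0" by simp
  obtain xs where xs: "u = (\<Sum>(a, b)\<leftarrow>xs. aten a b)"
      "(\<Sum>(a, b)\<leftarrow>xs. norm a * norm b) < proj_norm u + e / 2"
    using proj_norm_approx[OF \<open>e / 2 > 0\<close>] .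
  obtain ys where ys: "v = (\<Sum>(a, b)\<leftarrow>ys. aten a b)"
      "(\<Sum>(a, b)\<leftarrow>ys. norm a * norm b) < proj_norm v + e / 2"
    using proj_norm_approx[OF \<open>e / 2 > 0\<close>] .
  have "proj_norm (u + v) \<le> (\<Sum>(a, b)\<leftarrow>xs @ ys. norm a * norm b)"
    by (rule proj_norm_le) (simp add: xs(1) ys(1))
  then show "proj_norm (u + v) \<le> proj_norm u + proj_norm v + e" using xs(2) ys(2) by simp
qed

lemma linear_proj_bound:
  fixes T :: "('a::complex_normed_vector, 'b::complex_normed_vector) atensor \<Rightarrow> 'z::complex_normed_vector"
  assumes lin: "Vector_Spaces.linear scaleC scaleC T"
    and bd: "\<And>a b. norm (T (aten a b)) \<le> K * (norm a * norm b)" and "K \<ge> 0"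
  shows "norm (T u) \<le> K * proj_norm u"
proof (rule field_le_epsilon)
  interpret T: Vector_Spaces.linear scaleC scaleC T by (rule lin)
  fix e :: real assume "e > 0"
  then have "e / (K + 1) > 0" using \<open>K \<ge> 0\<close> by simp
  then obtain xs where xs: "u = (\<Sum>(a, b)\<leftarrow>xs. aten a b)"
      "(\<Sum>(a, b)\<leftarrow>xs. norm a * norm b) < proj_norm u + e / (K + 1)"
    using proj_norm_approx by blast
  have *: "norm (T (\<Sum>(a, b)\<leftarrow>xs. aten a b)) \<le> K * (\<Sum>(a, b)\<leftarrow>xs. norm a * norm b)" for xs
  proof (induction xs)
    case (Cons p xs)
    obtain a b where [simp]: "p = (a, b)" by (cases p)
    show ?case using norm_triangle_mono[OF bd[of a b] Cons]
      by (simp add: T.add distrib_left)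
  qed (simp add: T.zero)
  have "norm (T u) \<le> K * (proj_norm u + e / (K + 1))"
    unfolding xs(1) by (rule order_trans[OF *[of xs]])
      (use xs \<open>K \<ge> 0\<close> in \<open>auto intro!: mult_left_mono\<close>)
  also have "\<dots> \<le> K * proj_norm u + e"
  proof -
    have "K * (e / (K + 1)) = e * (K / (K + 1))" by simp
    also have "\<dots> \<le> e * 1"
      using \<open>K \<ge> 0\<close> \<open>e > 0\<close> by (intro mult_left_mono) auto
    finally show ?thesis by (simp add: distrib_left)
  qed
  finally show "norm (T u) \<le> K * proj_norm u + e" .
qed

lemma sum_list_aten_scaleC:
  "c *\<^sub>C (\<Sum>(a, b)\<leftarrow>xs. aten a b) = (\<Sum>(a, b)\<leftarrow>map (\<lambda>(a, b). (c *\<^sub>C a, b)) xs. aten a b)"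
  by (induction xs) (auto simp: scaleC_add_right aten_scaleC_left)

lemma proj_norm_scaleC_le: "proj_norm (c *\<^sub>C u) \<le> cmod c * proj_norm u"
proof (rule field_le_epsilon)
  fix e :: real assume "e > 0"
  then have "e / (cmod c + 1) > 0" by (simp add: add_nonneg_pos)
  then obtain xs where xs: "u = (\<Sum>(a, b)\<leftarrow>xs. aten a b)"
      "(\<Sum>(a, b)\<leftarrow>xs. norm a * norm b) < proj_norm u + e / (cmod c + 1)"
    using proj_norm_approx by blast
  have "proj_norm (c *\<^sub>C u) \<le> (\<Sum>(a, b)\<leftarrow>map (\<lambda>(a, b). (c *\<^sub>C a, b)) xs. norm a * norm b)"
    by (rule proj_norm_le) (simp only: xs(1) sum_list_aten_scaleC)
  also have "\<dots> = cmod c * (\<Sum>(a, b)\<leftarrow>xs. norm a * norm b)"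
    by (induction xs) (auto simp: norm_scaleC distrib_left)
  also have "\<dots> \<le> cmod c * (proj_norm u + e / (cmod c + 1))"
    using xs(2) by (intro mult_left_mono) auto
  also have "\<dots> \<le> cmod c * proj_norm u + e"
  proof -
    have "cmod c * (e / (cmod c + 1)) = e * (cmod c / (cmod c + 1))" by simp
    also have "\<dots> \<le> e * 1"
      using \<open>e > 0\<close> by (intro mult_left_mono) (auto simp: divide_le_eq add_nonneg_pos)
    finally show ?thesis by (simp add: distrib_left)
  qed
  finally show "proj_norm (c *\<^sub>C u) \<le> cmod c * proj_norm u + e" .
qed

lemma proj_norm_scaleC: "proj_norm (c *\<^sub>C u) = cmod c * proj_norm u"
proof (cases "c = 0")
  case False
  have "cmod c * proj_norm u = cmod c * proj_norm (inverse c *\<^sub>C c *\<^sub>C u)"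
    using False by (simp add: scaleC_scaleC)
  also have "\<dots> \<le> cmod c * (cmod (inverse c) * proj_norm (c *\<^sub>C u))"
    by (intro mult_left_mono proj_norm_scaleC_le) simp
  also have "\<dots> = proj_norm (c *\<^sub>C u)" using False by (simp add: norm_inverse)
  finally show ?thesis using proj_norm_scaleC_le[of c u] by simp
qed simp

lemma proj_norm_minus: "proj_norm (- u) = proj_norm u"
  using proj_norm_scaleC[of "-1" u] by simp

lemma proj_norm_minus_commute: "proj_norm (u - v) = proj_norm (v - u)"
  using proj_norm_minus[of "u - v"] by simp

lemma proj_norm_triangle_diff: "proj_norm (u - w) \<le> proj_norm (u - v) + proj_norm (v - w)"
  using proj_norm_triangle[of "u - v" "v - w"] by simp

lemma proj_norm_diff_abs: "\<bar>proj_norm u - proj_norm v\<bar> \<le> proj_norm (u - v)"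
  using proj_norm_triangle[of "u - v" v] proj_norm_triangle[of "v - u" u]
    proj_norm_minus_commute[of u v] by simp

text \<open>
  The projective tensor product is the completion of the algebraic tensor product:
  sequences that are Cauchy for \<^const>\<open>proj_norm\<close>, modulo null sequences.
\<close>

definition proj_Cauchy ::
  "(nat \<Rightarrow> ('a::complex_normed_vector, 'b::complex_normed_vector) atensor) \<Rightarrow> bool" where
  "proj_Cauchy X \<longleftrightarrow> (\<forall>e>0. \<exists>M. \<forall>m\<ge>M. \<forall>n\<ge>M. proj_norm (X m - X n) < e)"

definition ptensor_rel ::
  "(nat \<Rightarrow> ('a::complex_normed_vector, 'b::complex_normed_vector) atensor) \<Rightarrow>
   (nat \<Rightarrow> ('a, 'b) atensor) \<Rightarrow> bool" where
  "ptensor_rel X Y \<longleftrightarrow> proj_Cauchy X \<and> proj_Cauchy Y \<and> (\<lambda>n. proj_norm (X n - Y n)) \<longlonglongrightarrow> 0"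

lemma proj_null_mono:
  assumes "(\<lambda>n. g n) \<longlonglongrightarrow> 0" "\<And>n. proj_norm (f n) \<le> g n"
  shows "(\<lambda>n. proj_norm (f n)) \<longlonglongrightarrow> 0"
  by (rule tendsto_sandwich[OF _ _ tendsto_const assms(1)])
    (simp_all add: proj_norm_nonneg assms(2))

lemma proj_Cauchy_const: "proj_Cauchy (\<lambda>_. u)"
  by (simp add: proj_Cauchy_def)

lemma proj_Cauchy_add:
  assumes "proj_Cauchy X" "proj_Cauchy Y"
  shows "proj_Cauchy (\<lambda>n. X n + Y n)"
  unfolding proj_Cauchy_def
proof (intro allI impI)
  fix e :: real assume "e > 0"
  then have e2: "e / 2 > 0" by simp
  obtain M where M: "\<And>m n. m \<ge> M \<Longrightarrow> n \<ge> M \<Longrightarrow> proj_norm (X m - X n) < e / 2"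
    using assms(1)[unfolded proj_Cauchy_def, rule_format, OF e2] by auto
  obtain N where N: "\<And>m n. m \<ge> N \<Longrightarrow> n \<ge> N \<Longrightarrow> proj_norm (Y m - Y n) < e / 2"
    using assms(2)[unfolded proj_Cauchy_def, rule_format, OF e2] by auto
  have "proj_norm (X m + Y m - (X n + Y n)) < e" if "m \<ge> max M N" "n \<ge> max M N" for m n
  proof -
    have "proj_norm (X m + Y m - (X n + Y n)) \<le> proj_norm (X m - X n) + proj_norm (Y m - Y n)"
      unfolding add_diff_add by (rule proj_norm_triangle)
    then show ?thesis using M[of m n] N[of m n] that by simp
  qed
  then show "\<exists>M. \<forall>m\<ge>M. \<forall>n\<ge>M. proj_norm (X m + Y m - (X n + Y n)) < e" by blast
qed

lemma proj_Cauchy_scaleC: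
  assumes "proj_Cauchy X"
  shows "proj_Cauchy (\<lambda>n. c *\<^sub>C X n)"
  unfolding proj_Cauchy_def
proof (intro allI impI)
  fix e :: real assume "e > 0"
  have c: "cmod c + 1 > 0" by (simp add: add_nonneg_pos)
  then have e2: "e / (cmod c + 1) > 0" using \<open>e > 0\<close> by simp
  obtain M where M: "\<And>m n. m \<ge> M \<Longrightarrow> n \<ge> M \<Longrightarrow> proj_norm (X m - X n) < e / (cmod c + 1)"
    using assms[unfolded proj_Cauchy_def, rule_format, OF e2] by auto
  have "proj_norm (c *\<^sub>C X m - c *\<^sub>C X n) < e" if "m \<ge> M" "n \<ge> M" for m n
  proof -
    have "proj_norm (c *\<^sub>C X m - c *\<^sub>C X n) = cmod c * proj_norm (X m - X n)"
      by (simp add: complex_vector.scale_right_diff_distrib[symmetric] proj_norm_scaleC)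
    also have "\<dots> \<le> (cmod c + 1) * proj_norm (X m - X n)"
      by (simp add: distrib_right proj_norm_nonneg)
    also have "\<dots> < e" using M[OF that] c by (simp add: field_simps)
    finally show ?thesis .
  qed
  then show "\<exists>M. \<forall>m\<ge>M. \<forall>n\<ge>M. proj_norm (c *\<^sub>C X m - c *\<^sub>C X n) < e" by blast
qed

lemma proj_Cauchy_minus: "proj_Cauchy X \<Longrightarrow> proj_Cauchy (\<lambda>n. - X n)"
  using proj_Cauchy_scaleC[of X "-1"] by simp

lemma ptensor_rel_refl: "proj_Cauchy X \<Longrightarrow> ptensor_rel X X"
  by (simp add: ptensor_rel_def)

lemma ptensor_rel_sym: "ptensor_rel X Y \<Longrightarrow> ptensor_rel Y X"
  by (simp add: ptensor_rel_def proj_norm_minus_commute)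

lemma ptensor_rel_trans:
  assumes "ptensor_rel X Y" "ptensor_rel Y Z"
  shows "ptensor_rel X Z"
proof -
  have "(\<lambda>n. proj_norm (X n - Y n) + proj_norm (Y n - Z n)) \<longlonglongrightarrow> 0 + 0"
    using assms unfolding ptensor_rel_def by (intro tendsto_add) auto
  then have "(\<lambda>n. proj_norm (X n - Z n)) \<longlonglongrightarrow> 0"
    by (intro proj_null_mono[where g = "\<lambda>n. proj_norm (X n - Y n) + proj_norm (Y n - Z n)"])
      (simp_all add: proj_norm_triangle_diff)
  then show ?thesis using assms by (simp add: ptensor_rel_def)
qed

lemma ptensor_rel_add:
  assumes "ptensor_rel X X'" "ptensor_rel Y Y'"
  shows "ptensor_rel (\<lambda>n. X n + Y n) (\<lambda>n. X' n + Y' n)"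
proof -
  have "(\<lambda>n. proj_norm (X n - X' n) + proj_norm (Y n - Y' n)) \<longlonglongrightarrow> 0 + 0"
    using assms unfolding ptensor_rel_def by (intro tendsto_add) auto
  then have "(\<lambda>n. proj_norm (X n + Y n - (X' n + Y' n))) \<longlonglongrightarrow> 0"
    by (intro proj_null_mono[where g = "\<lambda>n. proj_norm (X n - X' n) + proj_norm (Y n - Y' n)"])
      (simp_all only: add_0 add_diff_add proj_norm_triangle)
  then show ?thesis using assms by (simp add: ptensor_rel_def proj_Cauchy_add)
qed

lemma ptensor_rel_scaleC:
  assumes "ptensor_rel X X'"
  shows "ptensor_rel (\<lambda>n. c *\<^sub>C X n) (\<lambda>n. c *\<^sub>C X' n)"
proof -
  have "(\<lambda>n. cmod c * proj_norm (X n - X' n)) \<longlonglongrightarrow> cmod c * 0"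
    using assms unfolding ptensor_rel_def by (intro tendsto_mult_left) auto
  then show ?thesis using assms
    by (simp add: ptensor_rel_def proj_Cauchy_scaleC proj_norm_scaleC
        complex_vector.scale_right_diff_distrib[symmetric])
qed

lemma ptensor_rel_minus:
  assumes "ptensor_rel X X'"
  shows "ptensor_rel (\<lambda>n. - X n) (\<lambda>n. - X' n)"
  using ptensor_rel_scaleC[OF assms, of "-1"] by simp

lemma ptensor_rel_diff:
  assumes "ptensor_rel X X'" "ptensor_rel Y Y'"
  shows "ptensor_rel (\<lambda>n. X n - Y n) (\<lambda>n. X' n - Y' n)"
  using ptensor_rel_add[OF assms(1) ptensor_rel_minus[OF assms(2)]] by simp

lemma proj_norm_convergent:
  assumes "proj_Cauchy X"
  shows "(\<lambda>n. proj_norm (X n)) \<longlonglongrightarrow> lim (\<lambda>n. proj_norm (X n))"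
proof -
  have "Cauchy (\<lambda>n. proj_norm (X n))"
  proof (rule metric_CauchyI)
    fix e :: real assume "e > 0"
    then obtain M where M: "\<And>m n. m \<ge> M \<Longrightarrow> n \<ge> M \<Longrightarrow> proj_norm (X m - X n) < e"
      using assms[unfolded proj_Cauchy_def, rule_format, OF \<open>e > 0\<close>] by auto
    have "dist (proj_norm (X m)) (proj_norm (X n)) < e" if "m \<ge> M" "n \<ge> M" for m n
      using le_less_trans[OF proj_norm_diff_abs M[OF that]] unfolding dist_real_def .
    then show "\<exists>M. \<forall>m\<ge>M. \<forall>n\<ge>M. dist (proj_norm (X m)) (proj_norm (X n)) < e"
      by (intro exI[of _ M]) auto
  qed
  then show ?thesis unfolding Cauchy_convergent_iff convergent_LIMSEQ_iff .
qed

lemma ptensor_rel_norm: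
  assumes "ptensor_rel X Y"
  shows "lim (\<lambda>n. proj_norm (X n)) = lim (\<lambda>n. proj_norm (Y n))"
proof -
  have "(\<lambda>n. proj_norm (X n) - proj_norm (Y n)) \<longlonglongrightarrow> 0"
  proof (rule Lim_null_comparison)
    show "(\<lambda>n. proj_norm (X n - Y n)) \<longlonglongrightarrow> 0" using assms unfolding ptensor_rel_def by blast
    show "\<forall>\<^sub>F n in sequentially. norm (proj_norm (X n) - proj_norm (Y n)) \<le> proj_norm (X n - Y n)"
      unfolding real_norm_def by (rule always_eventually) (intro allI proj_norm_diff_abs)
  qed
  moreover have "(\<lambda>n. proj_norm (X n) - proj_norm (Y n)) \<longlonglongrightarrow>
      lim (\<lambda>n. proj_norm (X n)) - lim (\<lambda>n. proj_norm (Y n))"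
    using assms unfolding ptensor_rel_def by (intro tendsto_diff proj_norm_convergent) auto
  ultimately have "0 = lim (\<lambda>n. proj_norm (X n)) - lim (\<lambda>n. proj_norm (Y n))"
    by (rule LIMSEQ_unique)
  then show ?thesis by simp
qed

quotient_type (overloaded) ('a, 'b) ptensor =
  "nat \<Rightarrow> ('a::complex_normed_vector, 'b::complex_normed_vector) atensor" /
  partial: ptensor_rel
proof (rule part_equivpI)
  show "\<exists>X :: nat \<Rightarrow> ('a, 'b) atensor. ptensor_rel X X"
    using ptensor_rel_refl[OF proj_Cauchy_const] by blast
  show "symp (ptensor_rel :: (nat \<Rightarrow> ('a, 'b) atensor) \<Rightarrow> _)"
    by (rule sympI) (rule ptensor_rel_sym)
  show "transp (ptensor_rel :: (nat \<Rightarrow> ('a, 'b) atensor) \<Rightarrow> _)"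
    by (rule transpI) (rule ptensor_rel_trans)
qed

lemma ptensor_cases:
  obtains X where "proj_Cauchy X" "z = abs_ptensor X"
proof
  show "z = abs_ptensor (rep_ptensor z)"
    by (rule Quotient_abs_rep[OF Quotient_ptensor, symmetric])
  show "proj_Cauchy (rep_ptensor z)"
    using Quotient_rep_reflp[OF Quotient_ptensor, of z] by (simp add: ptensor_rel_def)
qed

lemma abs_ptensor_eq_iff:
  "proj_Cauchy X \<Longrightarrow> proj_Cauchy Y \<Longrightarrow>
    abs_ptensor X = abs_ptensor Y \<longleftrightarrow> (\<lambda>n. proj_norm (X n - Y n)) \<longlonglongrightarrow> 0"
  using Quotient_rel[OF Quotient_ptensor, of X Y] by (auto simp: ptensor_rel_def)

instantiation ptensor :: (complex_normed_vector, complex_normed_vector) complex_normed_vector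
begin
lift_definition zero_ptensor :: "('a, 'b) ptensor" is "\<lambda>_. 0"
  by (rule ptensor_rel_refl[OF proj_Cauchy_const])
lift_definition plus_ptensor :: "('a, 'b) ptensor \<Rightarrow> ('a, 'b) ptensor \<Rightarrow> ('a, 'b) ptensor"
  is "\<lambda>X Y n. X n + Y n" by (rule ptensor_rel_add)
lift_definition minus_ptensor :: "('a, 'b) ptensor \<Rightarrow> ('a, 'b) ptensor \<Rightarrow> ('a, 'b) ptensor"
  is "\<lambda>X Y n. X n - Y n" by (rule ptensor_rel_diff)
lift_definition uminus_ptensor :: "('a, 'b) ptensor \<Rightarrow> ('a, 'b) ptensor"
  is "\<lambda>X n. - X n" by (rule ptensor_rel_minus)
lift_definition scaleC_ptensor :: "complex \<Rightarrow> ('a, 'b) ptensor \<Rightarrow> ('a, 'b) ptensor"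
  is "\<lambda>c X n. c *\<^sub>C X n" by (rule ptensor_rel_scaleC)
lift_definition norm_ptensor :: "('a, 'b) ptensor \<Rightarrow> real"
  is "\<lambda>X. lim (\<lambda>n. proj_norm (X n))" by (rule ptensor_rel_norm)
definition scaleR_ptensor :: "real \<Rightarrow> ('a, 'b) ptensor \<Rightarrow> ('a, 'b) ptensor" where
  "scaleR_ptensor r z = complex_of_real r *\<^sub>C z"
definition dist_ptensor :: "('a, 'b) ptensor \<Rightarrow> ('a, 'b) ptensor \<Rightarrow> real" where
  "dist_ptensor z w = norm (z - w)"
definition sgn_ptensor :: "('a, 'b) ptensor \<Rightarrow> ('a, 'b) ptensor" where
  "sgn_ptensor z = inverse (norm z) *\<^sub>R z"
definition uniformity_ptensor :: "(('a, 'b) ptensor \<times> ('a, 'b) ptensor) filter" where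
  "uniformity_ptensor = (INF e\<in>{0 <..}. principal {(z, w). dist z w < e})"
definition open_ptensor :: "('a, 'b) ptensor set \<Rightarrow> bool" where
  "open_ptensor U = (\<forall>z\<in>U. eventually (\<lambda>(z', w). z' = z \<longrightarrow> w \<in> U) uniformity)"

lemma abs_ptensor_add: "proj_Cauchy X \<Longrightarrow> proj_Cauchy Y \<Longrightarrow>
    abs_ptensor X + abs_ptensor Y = abs_ptensor (\<lambda>n. X n + Y n)"
  by (rule plus_ptensor.abs_eq) (auto intro: ptensor_rel_refl)
lemma abs_ptensor_diff: "proj_Cauchy X \<Longrightarrow> proj_Cauchy Y \<Longrightarrow>
    abs_ptensor X - abs_ptensor Y = abs_ptensor (\<lambda>n. X n - Y n)"
  by (rule minus_ptensor.abs_eq) (auto intro: ptensor_rel_refl)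
lemma abs_ptensor_minus: "proj_Cauchy X \<Longrightarrow> - abs_ptensor X = abs_ptensor (\<lambda>n. - X n)"
  by (rule uminus_ptensor.abs_eq) (auto intro: ptensor_rel_refl)
lemma abs_ptensor_scaleC:
  "proj_Cauchy X \<Longrightarrow> c *\<^sub>C abs_ptensor X = abs_ptensor (\<lambda>n. c *\<^sub>C X n)"
  by (rule scaleC_ptensor.abs_eq) (auto intro: ptensor_rel_refl)
lemma norm_abs_ptensor_tendsto:
  "proj_Cauchy X \<Longrightarrow> (\<lambda>n. proj_norm (X n)) \<longlonglongrightarrow> norm (abs_ptensor X)"
  using norm_ptensor.abs_eq[of X] proj_norm_convergent[of X] ptensor_rel_refl[of X] by simp

instance
proof
  fix z w y :: "('a, 'b) ptensor" and c d :: complex and r s :: real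
  show scaleR: "r *\<^sub>R z = complex_of_real r *\<^sub>C z" for r and z :: "('a, 'b) ptensor"
    by (rule scaleR_ptensor_def)
  obtain Z where Z: "proj_Cauchy Z" "z = abs_ptensor Z" by (rule ptensor_cases)
  obtain W where W: "proj_Cauchy W" "w = abs_ptensor W" by (rule ptensor_cases)
  obtain Y where Y: "proj_Cauchy Y" "y = abs_ptensor Y" by (rule ptensor_cases)
  note ops = abs_ptensor_add abs_ptensor_diff abs_ptensor_minus abs_ptensor_scaleC
    proj_Cauchy_add proj_Cauchy_scaleC proj_Cauchy_minus Z(1) W(1) Y(1)
  show "z + w + y = z + (w + y)" unfolding Z W Y by (simp add: ops add.assoc)
  show "z + w = w + z" unfolding Z W by (simp add: ops add.commute)
  show "0 + z = z" unfolding Z zero_ptensor_def by (simp add: ops proj_Cauchy_const)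
  show "- z + z = 0" unfolding Z zero_ptensor_def by (simp add: ops)
  show "z - w = z + - w" unfolding Z W by (simp add: ops)
  have a: "c *\<^sub>C (z + w) = c *\<^sub>C z + c *\<^sub>C w" for c
    unfolding Z W by (simp add: ops scaleC_add_right)
  have b: "(c + d) *\<^sub>C z = c *\<^sub>C z + d *\<^sub>C z" for c d
    unfolding Z by (simp add: ops scaleC_add_left)
  have e: "c *\<^sub>C d *\<^sub>C z = (c * d) *\<^sub>C z" for c d
    unfolding Z by (simp add: ops scaleC_scaleC)
  show "c *\<^sub>C (z + w) = c *\<^sub>C z + c *\<^sub>C w" by (rule a)
  show "(c + d) *\<^sub>C z = c *\<^sub>C z + d *\<^sub>C z" by (rule b)
  show "c *\<^sub>C d *\<^sub>C z = (c * d) *\<^sub>C z" by (rule e)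
  show "r *\<^sub>R (z + w) = r *\<^sub>R z + r *\<^sub>R w" by (simp only: scaleR a)
  show "(r + s) *\<^sub>R z = r *\<^sub>R z + s *\<^sub>R z" by (simp only: scaleR b of_real_add)
  show "r *\<^sub>R s *\<^sub>R z = (r * s) *\<^sub>R z" by (simp only: scaleR e of_real_mult)
  show "1 *\<^sub>R z = z" unfolding scaleR Z by (simp add: ops)
  show "dist z w = norm (z - w)" by (rule dist_ptensor_def)
  show "sgn z = inverse (norm z) *\<^sub>R z" by (rule sgn_ptensor_def)
  show "(uniformity :: (('a, 'b) ptensor \<times> ('a, 'b) ptensor) filter) =
      (INF e\<in>{0 <..}. principal {(z, w). dist z w < e})" by (rule uniformity_ptensor_def)
  show "open U = (\<forall>z\<in>U. eventually (\<lambda>(z', w). z' = z \<longrightarrow> w \<in> U) uniformity)"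
    for U :: "('a, 'b) ptensor set" by (rule open_ptensor_def)
  have nZ: "(\<lambda>n. proj_norm (Z n)) \<longlonglongrightarrow> norm z"
    unfolding Z(2) by (rule norm_abs_ptensor_tendsto[OF Z(1)])
  have nW: "(\<lambda>n. proj_norm (W n)) \<longlonglongrightarrow> norm w"
    unfolding W(2) by (rule norm_abs_ptensor_tendsto[OF W(1)])
  have "z = 0 \<longleftrightarrow> (\<lambda>n. proj_norm (Z n)) \<longlonglongrightarrow> 0"
    unfolding Z(2) zero_ptensor_def by (simp add: abs_ptensor_eq_iff[OF Z(1) proj_Cauchy_const])
  then show "norm z = 0 \<longleftrightarrow> z = 0" using nZ LIMSEQ_unique by metis
  have "(\<lambda>n. proj_norm (Z n + W n)) \<longlonglongrightarrow> norm (z + w)"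
    unfolding Z(2) W(2) abs_ptensor_add[OF Z(1) W(1)]
    by (rule norm_abs_ptensor_tendsto[OF proj_Cauchy_add[OF Z(1) W(1)]])
  then show "norm (z + w) \<le> norm z + norm w"
    by (rule LIMSEQ_le[OF _ tendsto_add[OF nZ nW]]) (simp add: proj_norm_triangle)
  have "(\<lambda>n. proj_norm (c *\<^sub>C Z n)) \<longlonglongrightarrow> norm (c *\<^sub>C z)" for c
    unfolding Z(2) abs_ptensor_scaleC[OF Z(1)]
    by (rule norm_abs_ptensor_tendsto[OF proj_Cauchy_scaleC[OF Z(1)]])
  then have n: "norm (c *\<^sub>C z) = cmod c * norm z" for c
    using tendsto_mult_left[OF nZ, of "cmod c"] LIMSEQ_unique
    unfolding proj_norm_scaleC by blast
  show "norm (c *\<^sub>C z) = cmod c * norm z" by (rule n)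
  show "norm (r *\<^sub>R z) = \<bar>r\<bar> * norm z" unfolding scaleR n by simp
qed
end

lemma abs_ptensor_const_tendsto:
  assumes "proj_Cauchy X"
  shows "(\<lambda>n. abs_ptensor (\<lambda>_. X n)) \<longlonglongrightarrow> abs_ptensor X"
proof (rule metric_LIMSEQ_I)
  fix e :: real assume "e > 0"
  then have e2: "e / 2 > 0" by simp
  obtain M where M: "\<And>m n. m \<ge> M \<Longrightarrow> n \<ge> M \<Longrightarrow> proj_norm (X m - X n) < e / 2"
    using assms[unfolded proj_Cauchy_def, rule_format, OF e2] by auto
  have "dist (abs_ptensor (\<lambda>_. X n)) (abs_ptensor X) < e" if "n \<ge> M" for n
  proof -
    have C: "proj_Cauchy (\<lambda>m. X n - X m)"
      using proj_Cauchy_add[OF proj_Cauchy_const proj_Cauchy_minus[OF assms], of "X n"] by simp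
    have eq: "abs_ptensor (\<lambda>_. X n) - abs_ptensor X = abs_ptensor (\<lambda>m. X n - X m)"
      by (rule abs_ptensor_diff[OF proj_Cauchy_const assms])
    have "norm (abs_ptensor (\<lambda>m. X n - X m)) \<le> e / 2"
    proof (rule LIMSEQ_le_const2[OF norm_abs_ptensor_tendsto[OF C]])
      show "\<exists>N. \<forall>m\<ge>N. proj_norm (X n - X m) \<le> e / 2"
        by (intro exI[of _ M] allI impI less_imp_le) (erule M[OF that])
    qed
    then show ?thesis unfolding dist_norm eq using \<open>e > 0\<close> by linarith
  qed
  then show "\<exists>N. \<forall>n\<ge>N. dist (abs_ptensor (\<lambda>_. X n)) (abs_ptensor X) < e"
    by (intro exI[of _ M]) auto
qed

definition ptensor_embed ::
  "('a::complex_normed_vector, 'b::complex_normed_vector) atensor \<Rightarrow> ('a, 'b) ptensor" where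
  "ptensor_embed u = abs_ptensor (\<lambda>_. u)"

lemma ptensor_embed_add: "ptensor_embed (u + v) = ptensor_embed u + ptensor_embed v"
  unfolding ptensor_embed_def by (simp add: abs_ptensor_add proj_Cauchy_const)
lemma ptensor_embed_diff: "ptensor_embed (u - v) = ptensor_embed u - ptensor_embed v"
  unfolding ptensor_embed_def by (simp add: abs_ptensor_diff proj_Cauchy_const)
lemma ptensor_embed_scaleC: "ptensor_embed (c *\<^sub>C u) = c *\<^sub>C ptensor_embed u"
  unfolding ptensor_embed_def by (simp add: abs_ptensor_scaleC proj_Cauchy_const)
lemma ptensor_embed_zero: "ptensor_embed 0 = 0"
  unfolding ptensor_embed_def zero_ptensor_def ..

text \<open>
  The next three facts say that \<^typ>\<open>('a, 'b) ptensor\<close> is a completion of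
  \<^typ>\<open>('a, 'b) atensor\<close> with respect to \<^const>\<open>proj_norm\<close>.
\<close>

lemma norm_ptensor_embed: "norm (ptensor_embed u) = proj_norm u"
  using norm_abs_ptensor_tendsto[OF proj_Cauchy_const, of u] unfolding ptensor_embed_def
  by (simp add: LIMSEQ_const_iff)

lemma ptensor_embed_dense: "e > 0 \<Longrightarrow> \<exists>u. dist (ptensor_embed u) z < e"
proof -
  assume "e > 0"
  obtain Z where Z: "proj_Cauchy Z" "z = abs_ptensor Z" by (rule ptensor_cases)
  obtain N where "\<And>n. n \<ge> N \<Longrightarrow> dist (ptensor_embed (Z n)) z < e"
    using metric_LIMSEQ_D[OF abs_ptensor_const_tendsto[OF Z(1)] \<open>e > 0\<close>]
    unfolding ptensor_embed_def Z(2) by auto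
  then show ?thesis by auto
qed

instance ptensor :: (complex_normed_vector, complex_normed_vector) complex_banach
proof
  fix Z :: "nat \<Rightarrow> ('a, 'b) ptensor"
  assume "Cauchy Z"
  have "\<exists>u. dist (ptensor_embed u) (Z n) < inverse (real (Suc n))" for n
    by (rule ptensor_embed_dense) simp
  then obtain U where U: "\<And>n. dist (ptensor_embed (U n)) (Z n) < inverse (real (Suc n))"
    by metis
  have D: "(\<lambda>n. dist (ptensor_embed (U n)) (Z n)) \<longlonglongrightarrow> 0"
    by (rule tendsto_sandwich[OF always_eventually always_eventually tendsto_const
          LIMSEQ_inverse_real_of_nat]) (intro allI zero_le_dist less_imp_le U)+
  have "proj_Cauchy U"
    unfolding proj_Cauchy_def
  proof (intro allI impI)
    fix e :: real assume "e > 0"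
    then have e3: "e / 3 > 0" by simp
    obtain M where M: "\<And>m n. m \<ge> M \<Longrightarrow> n \<ge> M \<Longrightarrow> dist (Z m) (Z n) < e / 3"
      using metric_CauchyD[OF \<open>Cauchy Z\<close> e3] by auto
    obtain N where N: "\<And>n. n \<ge> N \<Longrightarrow> dist (ptensor_embed (U n)) (Z n) < e / 3"
      using metric_LIMSEQ_D[OF D e3] by auto
    have "proj_norm (U m - U n) < e" if "m \<ge> max M N" "n \<ge> max M N" for m n
    proof -
      have "proj_norm (U m - U n) = dist (ptensor_embed (U m)) (ptensor_embed (U n))"
        by (simp add: dist_norm norm_ptensor_embed ptensor_embed_diff[symmetric])
      also have "\<dots> \<le> dist (ptensor_embed (U m)) (Z m) + dist (Z m) (ptensor_embed (U n))"
        by (rule dist_triangle)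
      also have "dist (Z m) (ptensor_embed (U n)) \<le>
          dist (Z m) (Z n) + dist (Z n) (ptensor_embed (U n))"
        by (rule dist_triangle)
      finally show ?thesis
        using M[of m n] N[of m] N[of n] that by (simp add: dist_commute)
    qed
    then show "\<exists>M. \<forall>m\<ge>M. \<forall>n\<ge>M. proj_norm (U m - U n) < e" by blast
  qed
  from abs_ptensor_const_tendsto[OF this]
  have L: "(\<lambda>n. ptensor_embed (U n)) \<longlonglongrightarrow> abs_ptensor U" unfolding ptensor_embed_def .
  have "(\<lambda>n. ptensor_embed (U n) - Z n) \<longlonglongrightarrow> 0"
    using D unfolding dist_norm by (rule tendsto_norm_zero_cancel)
  from tendsto_diff[OF L this] have "Z \<longlonglongrightarrow> abs_ptensor U" by simp
  then show "convergent Z" by (rule convergentI)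
qed

definition ptensor ::
  "'a::complex_normed_vector \<Rightarrow> 'b::complex_normed_vector \<Rightarrow> ('a, 'b) ptensor"
  (infixr "\<otimes>\<^sub>\<pi>" 71) where
  "a \<otimes>\<^sub>\<pi> b = ptensor_embed (aten a b)"

lemma norm_ptensor_le: "norm (a \<otimes>\<^sub>\<pi> b) \<le> norm a * norm b"
  unfolding ptensor_def norm_ptensor_embed by (rule proj_norm_aten)

lemma cbounded_bilinear_ptensor: "cbounded_bilinear (\<otimes>\<^sub>\<pi>)"
  unfolding cbounded_bilinear_def
proof (intro conjI allI)
  show "bounded_bilinear ((\<otimes>\<^sub>\<pi>) :: 'a \<Rightarrow> 'b \<Rightarrow> _)"
  proof
    show "\<exists>K. \<forall>a b. norm ((a :: 'a) \<otimes>\<^sub>\<pi> (b :: 'b)) \<le> norm a * norm b * K"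
      by (rule exI[of _ 1]) (simp add: norm_ptensor_le)
  qed (simp_all add: ptensor_def aten_add_left aten_add_right ptensor_embed_add
      scaleR_scaleC aten_scaleC_left aten_scaleC_right ptensor_embed_scaleC)
qed (simp_all add: ptensor_def aten_scaleC_left aten_scaleC_right ptensor_embed_scaleC)

lemma ptensor_ext:
  fixes S T :: "('a::complex_normed_vector, 'b::complex_normed_vector) ptensor \<Rightarrow> 'z::complex_normed_vector"
  assumes S: "cbounded_linear S" and T: "cbounded_linear T"
    and eq: "\<And>a b. S (a \<otimes>\<^sub>\<pi> b) = T (a \<otimes>\<^sub>\<pi> b)"
  shows "S = T"
proof
  fix z :: "('a, 'b) ptensor"
  interpret S: bounded_linear S using S by (simp add: cbounded_linear_def)
  interpret T: bounded_linear T using T by (simp add: cbounded_linear_def)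
  have sum: "S (ptensor_embed (\<Sum>(a, b)\<leftarrow>xs. aten a b)) = T (ptensor_embed (\<Sum>(a, b)\<leftarrow>xs. aten a b))" for xs
    by (induction xs)
      (auto simp: ptensor_embed_zero ptensor_embed_add S.zero T.zero S.add T.add
        eq[unfolded ptensor_def])
  have emb: "S (ptensor_embed u) = T (ptensor_embed u)" for u
  proof -
    obtain xs where xs: "u = (\<Sum>(a, b)\<leftarrow>xs. aten a b)" using atensor_decomp[of u] by (rule exE)
    show ?thesis unfolding xs by (rule sum)
  qed
  obtain Z where Z: "proj_Cauchy Z" "z = abs_ptensor Z" by (rule ptensor_cases)
  have L: "(\<lambda>n. ptensor_embed (Z n)) \<longlonglongrightarrow> z"
    using abs_ptensor_const_tendsto[OF Z(1)] unfolding ptensor_embed_def Z(2) .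
  from S.tendsto[OF L] T.tendsto[OF L] show "S z = T z"
    unfolding emb by (rule LIMSEQ_unique)
qed

lemma ptensor_lift_exists:
  fixes B :: "'a::complex_normed_vector \<Rightarrow> 'b::complex_normed_vector \<Rightarrow> 'z::complex_banach"
  assumes B: "cbounded_bilinear B" and K: "K \<ge> 0" "\<And>a b. norm (B a b) \<le> K * (norm a * norm b)"
  shows "\<exists>T. cbounded_linear T \<and> (\<forall>a b. T (a \<otimes>\<^sub>\<pi> b) = B a b) \<and> (\<forall>z. norm (T z) \<le> K * norm z)"
proof -
  interpret B: bounded_bilinear B using B by (simp add: cbounded_bilinear_def)
  have "\<exists>T. Vector_Spaces.linear scaleC scaleC T \<and> (\<forall>a b. T (aten a b) = B a b)"
    using B unfolding cbounded_bilinear_def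
    by (intro atensor_lift_exists) (auto simp: B.add_left B.add_right)
  then obtain T0 where lin: "Vector_Spaces.linear scaleC scaleC T0"
    and T0: "\<And>a b. T0 (aten a b) = B a b" by blast
  interpret T0: Vector_Spaces.linear scaleC scaleC T0 by (rule lin)
  have bd: "norm (T0 u) \<le> K * proj_norm u" for u
    by (rule linear_proj_bound[OF lin]) (simp_all add: T0 K)
  have bdd: "dist (T0 u) (T0 v) \<le> K * proj_norm (u - v)" for u v
    using bd[of "u - v"] by (simp add: dist_norm T0.diff)
  have conv: "convergent (\<lambda>n. T0 (X n))" if X: "proj_Cauchy X" for X
  proof -
    have "Cauchy (\<lambda>n. T0 (X n))"
    proof (rule metric_CauchyI)
      fix e :: real assume "e > 0"
      then have e: "e / (K + 1) > 0" using K(1) by simp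
      obtain M where M: "\<And>m n. m \<ge> M \<Longrightarrow> n \<ge> M \<Longrightarrow> proj_norm (X m - X n) < e / (K + 1)"
        using X[unfolded proj_Cauchy_def, rule_format, OF e] by auto
      have "dist (T0 (X m)) (T0 (X n)) < e" if "m \<ge> M" "n \<ge> M" for m n
      proof -
        have "dist (T0 (X m)) (T0 (X n)) \<le> K * proj_norm (X m - X n)" by (rule bdd)
        also have "\<dots> \<le> (K + 1) * proj_norm (X m - X n)"
          by (simp add: distrib_right proj_norm_nonneg)
        also have "\<dots> < e" using M[OF that] K(1) by (simp add: field_simps)
        finally show ?thesis .
      qed
      then show "\<exists>M. \<forall>m\<ge>M. \<forall>n\<ge>M. dist (T0 (X m)) (T0 (X n)) < e"
        by (intro exI[of _ M]) auto
    qed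
    then show ?thesis by (rule Cauchy_convergent)
  qed
  define T where "T z = lim (\<lambda>n. T0 (rep_ptensor z n))" for z
  have T_abs: "(\<lambda>n. T0 (X n)) \<longlonglongrightarrow> T (abs_ptensor X)" if X: "proj_Cauchy X" for X
  proof -
    let ?Y = "rep_ptensor (abs_ptensor X)"
    have Y: "proj_Cauchy ?Y"
      using Quotient_rep_reflp[OF Quotient_ptensor, of "abs_ptensor X"]
      by (simp add: ptensor_rel_def)
    have "abs_ptensor X = abs_ptensor ?Y"
      by (rule Quotient_abs_rep[OF Quotient_ptensor, symmetric])
    then have N: "(\<lambda>n. proj_norm (X n - ?Y n)) \<longlonglongrightarrow> 0"
      unfolding abs_ptensor_eq_iff[OF X Y] .
    have "(\<lambda>n. T0 (X n) - T0 (?Y n)) \<longlonglongrightarrow> 0"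
    proof (rule Lim_null_comparison)
      show "(\<lambda>n. K * proj_norm (X n - ?Y n)) \<longlonglongrightarrow> 0"
        using tendsto_mult_left[OF N, of K] by simp
      show "\<forall>\<^sub>F n in sequentially. norm (T0 (X n) - T0 (?Y n)) \<le> K * proj_norm (X n - ?Y n)"
        unfolding dist_norm[symmetric] by (rule always_eventually) (intro allI bdd)
    qed
    moreover have "(\<lambda>n. T0 (?Y n)) \<longlonglongrightarrow> T (abs_ptensor X)"
      unfolding T_def using conv[OF Y] by (simp add: convergent_LIMSEQ_iff)
    ultimately show ?thesis using tendsto_add by fastforce
  qed
  have T_emb: "T (ptensor_embed u) = T0 u" for u
    using T_abs[OF proj_Cauchy_const, of u] unfolding ptensor_embed_def
    by (simp add: LIMSEQ_const_iff)
  have T_add: "T (z + w) = T z + T w" for z w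
  proof -
    obtain Z where Z: "proj_Cauchy Z" "z = abs_ptensor Z" by (rule ptensor_cases)
    obtain W where W: "proj_Cauchy W" "w = abs_ptensor W" by (rule ptensor_cases)
    have "(\<lambda>n. T0 (Z n + W n)) \<longlonglongrightarrow> T (z + w)"
      unfolding Z(2) W(2) abs_ptensor_add[OF Z(1) W(1)]
      by (rule T_abs[OF proj_Cauchy_add[OF Z(1) W(1)]])
    moreover have "(\<lambda>n. T0 (Z n + W n)) \<longlonglongrightarrow> T z + T w"
      unfolding T0.add Z(2) W(2) by (intro tendsto_add T_abs Z W)
    ultimately show ?thesis by (rule LIMSEQ_unique)
  qed
  have T_scale: "T (c *\<^sub>C z) = c *\<^sub>C T z" for c z
  proof -
    obtain Z where Z: "proj_Cauchy Z" "z = abs_ptensor Z" by (rule ptensor_cases)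
    have "(\<lambda>n. T0 (c *\<^sub>C Z n)) \<longlonglongrightarrow> T (c *\<^sub>C z)"
      unfolding Z(2) abs_ptensor_scaleC[OF Z(1)]
      by (rule T_abs[OF proj_Cauchy_scaleC[OF Z(1)]])
    moreover have "(\<lambda>n. T0 (c *\<^sub>C Z n)) \<longlonglongrightarrow> c *\<^sub>C T z"
    proof -
      have "bounded_linear (\<lambda>x :: 'z. c *\<^sub>C x)"
        by (rule bounded_linear_intro[of _ "cmod c"])
          (simp_all add: scaleC_add_right scaleR_scaleC scaleC_scaleC mult.commute norm_scaleC)
      from bounded_linear.tendsto[OF this T_abs[OF Z(1)]]
      show ?thesis unfolding T0.scale Z(2) .
    qed
    ultimately show ?thesis by (rule LIMSEQ_unique)
  qed
  have T_bound: "norm (T z) \<le> K * norm z" for z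
  proof -
    obtain Z where Z: "proj_Cauchy Z" "z = abs_ptensor Z" by (rule ptensor_cases)
    have "(\<lambda>n. norm (T0 (Z n))) \<longlonglongrightarrow> norm (T z)"
      unfolding Z(2) by (intro tendsto_norm T_abs Z)
    moreover have "(\<lambda>n. K * proj_norm (Z n)) \<longlonglongrightarrow> K * norm z"
      unfolding Z(2) by (intro tendsto_mult_left norm_abs_ptensor_tendsto Z)
    ultimately show ?thesis by (rule LIMSEQ_le) (auto intro: bd)
  qed
  have "cbounded_linear T"
    unfolding cbounded_linear_def
    by (intro conjI allI T_scale bounded_linear_intro[of _ K])
      (simp_all add: T_add T_scale scaleR_scaleC T_bound mult.commute)
  moreover have "T (a \<otimes>\<^sub>\<pi> b) = B a b" for a b unfolding ptensor_def T_emb T0 ..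
  ultimately show ?thesis using T_bound by blast
qed

lemma ptensor_universal:
  fixes B :: "'a::complex_normed_vector \<Rightarrow> 'b::complex_normed_vector \<Rightarrow> 'z::complex_banach"
  assumes B: "cbounded_bilinear B"
  shows "\<exists>!T. cbounded_linear T \<and> (\<forall>a b. T (a \<otimes>\<^sub>\<pi> b) = B a b)"
proof -
  interpret B: bounded_bilinear B using B by (simp add: cbounded_bilinear_def)
  obtain K where "0 \<le> K" "\<And>a b. norm (B a b) \<le> norm a * norm b * K"
    using B.nonneg_bounded by blast
  then obtain T where "cbounded_linear T" "\<forall>a b. T (a \<otimes>\<^sub>\<pi> b) = B a b"
    using ptensor_lift_exists[OF B, of K] by (auto simp: mult.commute)
  then show ?thesis by (intro ex1I[of _ T]) (auto intro: ptensor_ext)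
qed

definition ptensor_lift ::
  "('a::complex_normed_vector \<Rightarrow> 'b::complex_normed_vector \<Rightarrow> 'z::complex_banach) \<Rightarrow>
   ('a, 'b) ptensor \<Rightarrow> 'z" where
  "ptensor_lift B = (THE T. cbounded_linear T \<and> (\<forall>a b. T (a \<otimes>\<^sub>\<pi> b) = B a b))"

lemma ptensor_lift:
  assumes "cbounded_bilinear B"
  shows cbounded_linear_ptensor_lift: "cbounded_linear (ptensor_lift B)"
    and ptensor_lift_ptensor: "ptensor_lift B (a \<otimes>\<^sub>\<pi> b) = B a b"
  using theI'[OF ptensor_universal[OF assms]] unfolding ptensor_lift_def[symmetric] by auto

lemma norm_ptensor_lift_le:
  assumes B: "cbounded_bilinear B" and K: "K \<ge> 0" "\<And>a b. norm (B a b) \<le> K * (norm a * norm b)"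
  shows "norm (ptensor_lift B z) \<le> K * norm z"
proof -
  obtain T where T: "cbounded_linear T" "\<And>a b. T (a \<otimes>\<^sub>\<pi> b) = B a b"
    "\<And>z. norm (T z) \<le> K * norm z"
    using ptensor_lift_exists[OF assms] by auto
  have "ptensor_lift B = T"
    by (rule ptensor_ext[OF cbounded_linear_ptensor_lift[OF B] T(1)])
      (simp add: ptensor_lift_ptensor[OF B] T(2))
  then show ?thesis using T(3) by simp
qed


section \<open>Dual spaces\<close>

typedef (overloaded) 'x cdual =
  "{f :: 'x::complex_normed_vector \<Rightarrow>\<^sub>L complex.
     \<forall>c x. blinfun_apply f (c *\<^sub>C x) = c * blinfun_apply f x}"
  by (rule exI[of _ 0]) simp

setup_lifting type_definition_cdual

instantiation cdual :: (complex_normed_vector) complex_normed_vector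
begin
lift_definition zero_cdual :: "'a cdual" is 0 by simp
lift_definition plus_cdual :: "'a cdual \<Rightarrow> 'a cdual \<Rightarrow> 'a cdual" is "(+)"
  by (simp add: plus_blinfun.rep_eq distrib_left)
lift_definition minus_cdual :: "'a cdual \<Rightarrow> 'a cdual \<Rightarrow> 'a cdual" is "(-)"
  by (simp add: minus_blinfun.rep_eq right_diff_distrib)
lift_definition uminus_cdual :: "'a cdual \<Rightarrow> 'a cdual" is uminus
  by (simp add: uminus_blinfun.rep_eq)
lift_definition scaleC_cdual :: "complex \<Rightarrow> 'a cdual \<Rightarrow> 'a cdual"
  is "\<lambda>c f. blinfun_mult_right c o\<^sub>L f" by simp
lift_definition scaleR_cdual :: "real \<Rightarrow> 'a cdual \<Rightarrow> 'a cdual" is scaleR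
  by (simp add: scaleR_blinfun.rep_eq)
lift_definition norm_cdual :: "'a cdual \<Rightarrow> real" is norm .
definition dist_cdual :: "'a cdual \<Rightarrow> 'a cdual \<Rightarrow> real" where
  "dist_cdual f g = norm (f - g)"
definition sgn_cdual :: "'a cdual \<Rightarrow> 'a cdual" where
  "sgn_cdual f = inverse (norm f) *\<^sub>R f"
definition uniformity_cdual :: "('a cdual \<times> 'a cdual) filter" where
  "uniformity_cdual = (INF e\<in>{0 <..}. principal {(f, g). dist f g < e})"
definition open_cdual :: "'a cdual set \<Rightarrow> bool" where
  "open_cdual U = (\<forall>f\<in>U. eventually (\<lambda>(f', g). f' = f \<longrightarrow> g \<in> U) uniformity)"
instance
proof
  fix f g h :: "'a cdual" and c d :: complex and r s :: real
  show "f + g + h = f + (g + h)" by transfer (rule add.assoc)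
  show "f + g = g + f" by transfer (rule add.commute)
  show "0 + f = f" by transfer simp
  show "- f + f = 0" by transfer simp
  show "f - g = f + - g" by transfer simp
  show "r *\<^sub>R (f + g) = r *\<^sub>R f + r *\<^sub>R g" by transfer (rule scaleR_add_right)
  show "(r + s) *\<^sub>R f = r *\<^sub>R f + s *\<^sub>R f" by transfer (rule scaleR_add_left)
  show "r *\<^sub>R s *\<^sub>R f = (r * s) *\<^sub>R f" by transfer simp
  show "1 *\<^sub>R f = f" by transfer simp
  show "c *\<^sub>C (f + g) = c *\<^sub>C f + c *\<^sub>C g"
    by transfer (auto intro!: blinfun_eqI simp: plus_blinfun.rep_eq distrib_left)
  show "(c + d) *\<^sub>C f = c *\<^sub>C f + d *\<^sub>C f"
    by transfer (auto intro!: blinfun_eqI simp: plus_blinfun.rep_eq distrib_right)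
  show "c *\<^sub>C d *\<^sub>C f = (c * d) *\<^sub>C f"
    by transfer (auto intro!: blinfun_eqI)
  show "r *\<^sub>R f = complex_of_real r *\<^sub>C f"
    by transfer (auto intro!: blinfun_eqI simp: scaleR_blinfun.rep_eq scaleR_conv_of_real)
  show "dist f g = norm (f - g)" by (rule dist_cdual_def)
  show "sgn f = inverse (norm f) *\<^sub>R f" by (rule sgn_cdual_def)
  show "(uniformity :: ('a cdual \<times> 'a cdual) filter) =
      (INF e\<in>{0 <..}. principal {(f, g). dist f g < e})" by (rule uniformity_cdual_def)
  show "open U = (\<forall>f\<in>U. eventually (\<lambda>(f', g). f' = f \<longrightarrow> g \<in> U) uniformity)"
    for U :: "'a cdual set" by (rule open_cdual_def)
  show "norm f = 0 \<longleftrightarrow> f = 0" by transfer simp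
  show "norm (f + g) \<le> norm f + norm g" by transfer (rule norm_triangle_ineq)
  show "norm (r *\<^sub>R f) = \<bar>r\<bar> * norm f" by transfer simp
  have le: "norm (c *\<^sub>C f) \<le> cmod c * norm f" for c and f :: "'a cdual"
  proof (transfer, rule norm_blinfun_bound)
    fix c :: complex and f :: "'a \<Rightarrow>\<^sub>L complex" and x
    show "norm (blinfun_apply (blinfun_mult_right c o\<^sub>L f) x) \<le> cmod c * norm f * norm x"
      using mult_left_mono[OF norm_blinfun[of f x], of "cmod c"]
      by (simp add: norm_mult mult.assoc)
  qed simp
  show "norm (c *\<^sub>C f) = cmod c * norm f"
  proof (cases "c = 0")
    case True
    have "norm (0 *\<^sub>C f) = 0" by transfer (simp add: blinfun_eqI)
    with True show ?thesis by simp
  next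
    case False
    have "inverse c *\<^sub>C c *\<^sub>C f = f"
      using False by transfer (auto intro!: blinfun_eqI)
    then have "cmod c * norm f \<le> cmod c * (cmod (inverse c) * norm (c *\<^sub>C f))"
      using le[of "inverse c" "c *\<^sub>C f"] by (simp add: mult_left_mono)
    also have "\<dots> = norm (c *\<^sub>C f)" using False by (simp add: norm_inverse)
    finally show ?thesis using le[of c f] by simp
  qed
qed
end

instance cdual :: (complex_normed_vector) complex_banach
proof
  fix F :: "nat \<Rightarrow> 'a cdual"
  assume F: "Cauchy F"
  have dist: "dist (Rep_cdual f) (Rep_cdual g) = dist f g" for f g :: "'a cdual"
    by (simp add: dist_norm norm_cdual.rep_eq minus_cdual.rep_eq)
  have "Cauchy (\<lambda>n. Rep_cdual (F n))"
    using F unfolding Cauchy_def dist .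
  then obtain L where L: "(\<lambda>n. Rep_cdual (F n)) \<longlonglongrightarrow> L"
    by (auto simp: Cauchy_convergent_iff convergent_def)
  have pt: "(\<lambda>n. blinfun_apply (Rep_cdual (F n)) x) \<longlonglongrightarrow> blinfun_apply L x" for x
    by (intro blinfun.tendsto L tendsto_const)
  have hom: "blinfun_apply (Rep_cdual f) (c *\<^sub>C x) = c * blinfun_apply (Rep_cdual f) x"
    for f :: "'a cdual" and c x
    using Rep_cdual[of f] by simp
  have "blinfun_apply L (c *\<^sub>C x) = c * blinfun_apply L x" for c x
  proof (rule LIMSEQ_unique[OF pt])
    show "(\<lambda>n. blinfun_apply (Rep_cdual (F n)) (c *\<^sub>C x)) \<longlonglongrightarrow> c * blinfun_apply L x"
      unfolding hom by (rule tendsto_mult_left[OF pt])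
  qed
  then have "Rep_cdual (Abs_cdual L) = L" by (intro Abs_cdual_inverse) simp
  with L have "F \<longlonglongrightarrow> Abs_cdual L"
    unfolding tendsto_iff by (metis (no_types, lifting) dist eventually_mono)
  then show "convergent F" by (rule convergentI)
qed

definition cdual_apply :: "'x::complex_normed_vector cdual \<Rightarrow> 'x \<Rightarrow> complex" where
  "cdual_apply f = blinfun_apply (Rep_cdual f)"

definition cdual_of :: "('x::complex_normed_vector \<Rightarrow> complex) \<Rightarrow> 'x cdual" where
  "cdual_of g = Abs_cdual (Blinfun g)"

lemma cbounded_linear_cdual_apply: "cbounded_linear (cdual_apply f)"
  using Rep_cdual[of f] unfolding cbounded_linear_def cdual_apply_def
  by (simp add: scaleC_complex_def bounded_linear_blinfun_apply blinfun.bounded_linear_right)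

lemma cdual_apply_cdual_of: "cbounded_linear g \<Longrightarrow> cdual_apply (cdual_of g) = g"
  unfolding cbounded_linear_def cdual_apply_def cdual_of_def
  by (simp add: Abs_cdual_inverse bounded_linear_Blinfun_apply scaleC_complex_def)

lemma cdual_eqI: "(\<And>x. cdual_apply f x = cdual_apply g x) \<Longrightarrow> f = g"
  unfolding cdual_apply_def by (metis Rep_cdual_inject blinfun_eqI)

lemma cdual_apply_add: "cdual_apply (f + g) x = cdual_apply f x + cdual_apply g x"
  by (simp add: cdual_apply_def plus_cdual.rep_eq plus_blinfun.rep_eq)

lemma cdual_apply_scaleC: "cdual_apply (c *\<^sub>C f) x = c * cdual_apply f x"
  by (simp add: cdual_apply_def scaleC_cdual.rep_eq)

lemma norm_cdual_apply: "norm (cdual_apply f x) \<le> norm f * norm x"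
  by (simp add: cdual_apply_def norm_cdual.rep_eq norm_blinfun)

lemma norm_cdual_bound:
  "K \<ge> 0 \<Longrightarrow> (\<And>x. norm (cdual_apply f x) \<le> K * norm x) \<Longrightarrow> norm f \<le> K"
  unfolding cdual_apply_def norm_cdual.rep_eq by (rule norm_blinfun_bound)

text \<open>The adjoint of a bounded linear map; its value is only meaningful for such maps.\<close>

definition cadjoint ::
  "('x::complex_normed_vector \<Rightarrow> 'y::complex_normed_vector) \<Rightarrow> 'y cdual \<Rightarrow> 'x cdual" where
  "cadjoint T f = cdual_of (\<lambda>x. cdual_apply f (T x))"

lemma cdual_apply_cadjoint:
  "cbounded_linear T \<Longrightarrow> cdual_apply (cadjoint T f) x = cdual_apply f (T x)"
  unfolding cadjoint_def
  by (subst cdual_apply_cdual_of)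
    (auto intro: cbounded_linear_compose cbounded_linear_cdual_apply)


section \<open>Banach bimodules\<close>

locale banach_bimodule =
  fixes lact :: "'a::complex_banach_algebra \<Rightarrow> 'x::complex_banach \<Rightarrow> 'x"
    and ract :: "'x \<Rightarrow> 'a \<Rightarrow> 'x"
  assumes cbounded_bilinear_lact: "cbounded_bilinear lact"
    and cbounded_bilinear_ract: "cbounded_bilinear ract"
    and lact_mult: "lact (a * b) x = lact a (lact b x)"
    and ract_mult: "ract x (a * b) = ract (ract x a) b"
    and lact_ract: "lact a (ract x b) = ract (lact a x) b"

lemma banach_bimodule_algebra:
  "banach_bimodule ((*) :: 'a::complex_banach_algebra \<Rightarrow> 'a \<Rightarrow> 'a) (*)"
  by unfold_locales (simp_all add: cbounded_bilinear_mult mult.assoc)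

text \<open>
  The actions on the dual:
  \<open>\<langle>a \<cdot> f, x\<rangle> = \<langle>f, x \<cdot> a\<rangle>\<close> and \<open>\<langle>f \<cdot> a, x\<rangle> = \<langle>f, a \<cdot> x\<rangle>\<close>, so that the left action on
  the dual comes from the right action \<open>ract\<close> and vice versa.
\<close>

definition dual_lact ::
  "('x::complex_normed_vector \<Rightarrow> 'a \<Rightarrow> 'x) \<Rightarrow> 'a \<Rightarrow> 'x cdual \<Rightarrow> 'x cdual" where
  "dual_lact ract a f = cdual_of (\<lambda>x. cdual_apply f (ract x a))"

definition dual_ract ::
  "('a \<Rightarrow> 'x::complex_normed_vector \<Rightarrow> 'x) \<Rightarrow> 'x cdual \<Rightarrow> 'a \<Rightarrow> 'x cdual" where
  "dual_ract lact f a = cdual_of (\<lambda>x. cdual_apply f (lact a x))"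

context banach_bimodule
begin

lemma cdual_apply_dual_lact: "cdual_apply (dual_lact ract a f) x = cdual_apply f (ract x a)"
  unfolding dual_lact_def
  by (subst cdual_apply_cdual_of)
    (auto intro: cbounded_linear_compose[OF cbounded_linear_cdual_apply]
      cbounded_bilinear_left[OF cbounded_bilinear_ract])

lemma cdual_apply_dual_ract: "cdual_apply (dual_ract lact f a) x = cdual_apply f (lact a x)"
  unfolding dual_ract_def
  by (subst cdual_apply_cdual_of)
    (auto intro: cbounded_linear_compose[OF cbounded_linear_cdual_apply]
      cbounded_bilinear_right[OF cbounded_bilinear_lact])

lemma banach_bimodule_dual: "banach_bimodule (dual_lact ract) (dual_ract lact)"
proof -
  interpret l: bounded_bilinear lact
    using cbounded_bilinear_lact by (simp add: cbounded_bilinear_def)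
  interpret r: bounded_bilinear ract
    using cbounded_bilinear_ract by (simp add: cbounded_bilinear_def)
  note f = cbounded_linear_cdual_apply[unfolded cbounded_linear_def]
  have f_add: "cdual_apply f (x + y) = cdual_apply f x + cdual_apply f y"
    for f :: "'x cdual" and x y
    using f[of f] by (simp add: linear_simps(1))
  have f_scale: "cdual_apply f (c *\<^sub>C x) = c * cdual_apply f x" for f :: "'x cdual" and c x
    using f[of f] by (simp add: scaleC_complex_def)
  have l_scale: "lact (c *\<^sub>C a) x = c *\<^sub>C lact a x" "ract x (c *\<^sub>C a) = c *\<^sub>C ract x a" for c a x
    using cbounded_bilinear_lact cbounded_bilinear_ract by (simp_all add: cbounded_bilinear_def)
  note simps = cdual_apply_dual_lact cdual_apply_dual_ract cdual_apply_add cdual_apply_scaleC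
    l.add_left l.add_right r.add_left r.add_right f_add f_scale l_scale
  obtain K where K: "0 \<le> K" "\<And>a x. norm (lact a x) \<le> norm a * norm x * K"
    using l.nonneg_bounded by blast
  obtain K' where K': "0 \<le> K'" "\<And>x a. norm (ract x a) \<le> norm x * norm a * K'"
    using r.nonneg_bounded by blast
  have bl: "norm (dual_lact ract a f) \<le> norm a * norm f * K'" for a f
  proof (rule norm_cdual_bound)
    fix x
    have "norm (cdual_apply f (ract x a)) \<le> norm f * norm (ract x a)" by (rule norm_cdual_apply)
    also have "\<dots> \<le> norm f * (norm x * norm a * K')" by (intro mult_left_mono K') simp
    finally show "norm (cdual_apply (dual_lact ract a f) x) \<le> norm a * norm f * K' * norm x"
      by (simp add: simps mult_ac)
  qed (simp add: K')
  have br: "norm (dual_ract lact f a) \<le> norm f * norm a * K" for a f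
  proof (rule norm_cdual_bound)
    fix x
    have "norm (cdual_apply f (lact a x)) \<le> norm f * norm (lact a x)" by (rule norm_cdual_apply)
    also have "\<dots> \<le> norm f * (norm a * norm x * K)" by (intro mult_left_mono K) simp
    finally show "norm (cdual_apply (dual_ract lact f a) x) \<le> norm f * norm a * K * norm x"
      by (simp add: simps mult_ac)
  qed (simp add: K)
  show ?thesis
  proof
    show "cbounded_bilinear (dual_lact ract)"
      unfolding cbounded_bilinear_def
    proof (intro conjI allI)
      show "bounded_bilinear (dual_lact ract)"
        by unfold_locales
          (auto intro!: cdual_eqI exI[of _ K'] bl simp: simps scaleR_scaleC)
    qed (auto intro!: cdual_eqI simp: simps)
    show "cbounded_bilinear (dual_ract lact)"
      unfolding cbounded_bilinear_def
    proof (intro conjI allI)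
      show "bounded_bilinear (dual_ract lact)"
        by unfold_locales
          (auto intro!: cdual_eqI exI[of _ K] br simp: simps scaleR_scaleC)
    qed (auto intro!: cdual_eqI simp: simps)
  qed (auto intro!: cdual_eqI simp: simps lact_mult ract_mult lact_ract)
qed

end

definition ptensor_lact ::
  "'a::complex_banach_algebra \<Rightarrow> ('a, 'a) ptensor \<Rightarrow> ('a, 'a) ptensor" where
  "ptensor_lact a = ptensor_lift (\<lambda>b c. (a * b) \<otimes>\<^sub>\<pi> c)"

definition ptensor_ract ::
  "('a::complex_banach_algebra, 'a) ptensor \<Rightarrow> 'a \<Rightarrow> ('a, 'a) ptensor" where
  "ptensor_ract z a = ptensor_lift (\<lambda>b c. b \<otimes>\<^sub>\<pi> (c * a)) z"

definition ptensor_diag :: "('a::complex_banach_algebra, 'a) ptensor \<Rightarrow> 'a" where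
  "ptensor_diag = ptensor_lift (*)"

lemma cbounded_bilinear_compose:
  assumes B: "cbounded_bilinear B" and f: "cbounded_linear f" and g: "cbounded_linear g"
  shows "cbounded_bilinear (\<lambda>x y. B (f x) (g y))"
proof -
  interpret B: bounded_bilinear B using B by (simp add: cbounded_bilinear_def)
  have "bounded_bilinear (\<lambda>x y. B (f x) (g y))"
    using f g by (intro B.comp) (simp_all add: cbounded_linear_def)
  then show ?thesis using assms by (simp add: cbounded_bilinear_def cbounded_linear_def)
qed

lemma cbounded_linear_ident: "cbounded_linear (\<lambda>x. x)"
  by (simp add: cbounded_linear_def bounded_linear_ident)

lemma cbounded_bilinear_ptensor_lact: "cbounded_bilinear (\<lambda>b c. (a * b) \<otimes>\<^sub>\<pi> c)"
  for a :: "'a::complex_banach_algebra"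
  by (intro cbounded_bilinear_compose[OF cbounded_bilinear_ptensor]
      cbounded_bilinear_right[OF cbounded_bilinear_mult] cbounded_linear_ident)

lemma cbounded_bilinear_ptensor_ract: "cbounded_bilinear (\<lambda>b c. b \<otimes>\<^sub>\<pi> (c * a))"
  for a :: "'a::complex_banach_algebra"
  by (intro cbounded_bilinear_compose[OF cbounded_bilinear_ptensor]
      cbounded_bilinear_left[OF cbounded_bilinear_mult] cbounded_linear_ident)

lemma ptensor_lact_ptensor [simp]: "ptensor_lact a (b \<otimes>\<^sub>\<pi> c) = (a * b) \<otimes>\<^sub>\<pi> c"
  unfolding ptensor_lact_def by (rule ptensor_lift_ptensor[OF cbounded_bilinear_ptensor_lact])

lemma ptensor_ract_ptensor [simp]: "ptensor_ract (b \<otimes>\<^sub>\<pi> c) a = b \<otimes>\<^sub>\<pi> (c * a)"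
  unfolding ptensor_ract_def by (rule ptensor_lift_ptensor[OF cbounded_bilinear_ptensor_ract])

lemma ptensor_diag_ptensor [simp]: "ptensor_diag (a \<otimes>\<^sub>\<pi> b) = a * b"
  unfolding ptensor_diag_def by (rule ptensor_lift_ptensor[OF cbounded_bilinear_mult])

lemma cbounded_linear_ptensor_lact: "cbounded_linear (ptensor_lact a)"
  unfolding ptensor_lact_def
  by (rule cbounded_linear_ptensor_lift[OF cbounded_bilinear_ptensor_lact])

lemma cbounded_linear_ptensor_ract: "cbounded_linear (\<lambda>z. ptensor_ract z a)"
  unfolding ptensor_ract_def
  by (rule cbounded_linear_ptensor_lift[OF cbounded_bilinear_ptensor_ract])

lemma cbounded_linear_ptensor_diag: "cbounded_linear ptensor_diag"
  unfolding ptensor_diag_def by (rule cbounded_linear_ptensor_lift[OF cbounded_bilinear_mult])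

lemma cbounded_linear_add:
  "cbounded_linear f \<Longrightarrow> cbounded_linear g \<Longrightarrow> cbounded_linear (\<lambda>x. f x + g x)"
  by (simp add: cbounded_linear_def bounded_linear_add scaleC_add_right)

lemma cbounded_linear_scaleC:
  "cbounded_linear f \<Longrightarrow> cbounded_linear (\<lambda>x. c *\<^sub>C f x)"
proof -
  have "bounded_linear (\<lambda>x :: 'b. c *\<^sub>C x)"
    by (rule bounded_linear_intro[of _ "cmod c"])
      (simp_all add: scaleC_add_right scaleR_scaleC scaleC_scaleC mult.commute norm_scaleC)
  then show "cbounded_linear f \<Longrightarrow> cbounded_linear (\<lambda>x. c *\<^sub>C f x)"
    by (simp add: cbounded_linear_def bounded_linear_compose scaleC_scaleC mult.commute)
qed

lemma banach_bimodule_ptensor: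
  "banach_bimodule (ptensor_lact :: 'a::complex_banach_algebra \<Rightarrow> _) ptensor_ract"
proof
  note pt = cbounded_bilinear_ptensor[unfolded cbounded_bilinear_def]
  note add = bounded_bilinear.add_left[OF conjunct1[OF pt]]
    bounded_bilinear.add_right[OF conjunct1[OF pt]]
  note lin = cbounded_linear_ptensor_lact cbounded_linear_ptensor_ract
    cbounded_linear_add cbounded_linear_scaleC cbounded_linear_compose
  have la: "ptensor_lact (a + b) z = ptensor_lact a z + ptensor_lact b z" for a b :: 'a and z
    by (rule fun_cong[OF ptensor_ext]) (simp_all add: lin distrib_right add)
  have ra: "ptensor_ract z (a + b) = ptensor_ract z a + ptensor_ract z b" for a b :: 'a and z
    by (rule fun_cong[OF ptensor_ext]) (simp_all add: lin distrib_left add)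
  have ls: "ptensor_lact (c *\<^sub>C a) z = c *\<^sub>C ptensor_lact a z" for a :: 'a and c z
    by (rule fun_cong[OF ptensor_ext]) (simp_all add: lin mult_scaleC_left pt)
  have rs: "ptensor_ract z (c *\<^sub>C a) = c *\<^sub>C ptensor_ract z a" for a :: 'a and c z
    by (rule fun_cong[OF ptensor_ext]) (simp_all add: lin mult_scaleC_right pt)
  have ln: "norm (ptensor_lact a z) \<le> norm a * norm z" for a :: 'a and z
    unfolding ptensor_lact_def
  proof (rule norm_ptensor_lift_le[OF cbounded_bilinear_ptensor_lact])
    fix b c :: 'a
    have "norm ((a * b) \<otimes>\<^sub>\<pi> c) \<le> norm (a * b) * norm c" by (rule norm_ptensor_le)
    also have "\<dots> \<le> norm a * norm b * norm c" by (intro mult_right_mono norm_mult_ineq) simp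
    finally show "norm ((a * b) \<otimes>\<^sub>\<pi> c) \<le> norm a * (norm b * norm c)" by (simp add: mult.assoc)
  qed simp
  have rn: "norm (ptensor_ract z a) \<le> norm a * norm z" for a :: 'a and z
    unfolding ptensor_ract_def
  proof (rule norm_ptensor_lift_le[OF cbounded_bilinear_ptensor_ract])
    fix b c :: 'a
    have "norm (b \<otimes>\<^sub>\<pi> (c * a)) \<le> norm b * norm (c * a)" by (rule norm_ptensor_le)
    also have "\<dots> \<le> norm b * (norm c * norm a)" by (intro mult_left_mono norm_mult_ineq) simp
    finally show "norm (b \<otimes>\<^sub>\<pi> (c * a)) \<le> norm a * (norm b * norm c)" by (simp add: mult_ac)
  qed simp
  have l: "bounded_linear (ptensor_lact a)" "ptensor_lact a (c *\<^sub>C z) = c *\<^sub>C ptensor_lact a z"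
    for a :: 'a and c z
    using cbounded_linear_ptensor_lact[of a] by (simp_all add: cbounded_linear_def)
  have r: "bounded_linear (\<lambda>z. ptensor_ract z a)"
    "ptensor_ract (c *\<^sub>C z) a = c *\<^sub>C ptensor_ract z a" for a :: 'a and c z
    using cbounded_linear_ptensor_ract[of a] by (simp_all add: cbounded_linear_def)
  note simps = la ra ls rs l(2) r(2) scaleR_scaleC
  have "bounded_bilinear (ptensor_lact :: 'a \<Rightarrow> _)"
  proof
    show "\<exists>K. \<forall>a z. norm (ptensor_lact (a :: 'a) z) \<le> norm a * norm z * K"
      by (rule exI[of _ 1]) (simp add: ln)
  qed (simp_all add: simps linear_simps(1)[OF l(1)])
  then show "cbounded_bilinear (ptensor_lact :: 'a \<Rightarrow> _)"
    by (simp add: cbounded_bilinear_def simps)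
  have "bounded_bilinear (ptensor_ract :: _ \<Rightarrow> 'a \<Rightarrow> _)"
  proof
    show "\<exists>K. \<forall>z a. norm (ptensor_ract z (a :: 'a)) \<le> norm z * norm a * K"
      by (rule exI[of _ 1]) (simp add: rn mult.commute)
  qed (simp_all add: simps linear_simps(1)[OF r(1)])
  then show "cbounded_bilinear (ptensor_ract :: _ \<Rightarrow> 'a \<Rightarrow> _)"
    by (simp add: cbounded_bilinear_def simps)
  show "ptensor_lact (a * b) z = ptensor_lact a (ptensor_lact b z)" for a b :: 'a and z
    by (rule fun_cong[OF ptensor_ext]) (simp_all add: lin mult.assoc)
  show "ptensor_ract z (a * b) = ptensor_ract (ptensor_ract z a) b" for a b :: 'a and z
    by (rule fun_cong[OF ptensor_ext])
      (simp_all add: mult.assoc cbounded_linear_ptensor_ract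
        cbounded_linear_compose[OF cbounded_linear_ptensor_ract cbounded_linear_ptensor_ract])
  show "ptensor_lact a (ptensor_ract z b) = ptensor_ract (ptensor_lact a z) b" for a b :: 'a and z
    by (rule fun_cong[OF ptensor_ext])
      (simp_all add: 
        cbounded_linear_compose[OF cbounded_linear_ptensor_ract cbounded_linear_ptensor_lact]
        cbounded_linear_compose[OF cbounded_linear_ptensor_lact cbounded_linear_ptensor_ract])
qed


section \<open>Biprojectivity and biflatness relative to an endomorphism\<close>

definition alg_Hom :: "('a::complex_banach_algebra \<Rightarrow> 'a) set" where
  "alg_Hom = {\<sigma>. Vector_Spaces.linear scaleC scaleC \<sigma> \<and> (\<forall>a b. \<sigma> (a * b) = \<sigma> a * \<sigma> b) \<and>
     continuous_on UNIV \<sigma>}"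

lemma alg_Hom_cbounded_linear:
  assumes "\<sigma> \<in> alg_Hom"
  shows "cbounded_linear \<sigma>"
proof -
  interpret Vector_Spaces.linear scaleC scaleC \<sigma> using assms by (simp add: alg_Hom_def)
  have scaleR: "\<sigma> (r *\<^sub>R x) = r *\<^sub>R \<sigma> x" for r x by (simp add: scaleR_scaleC scale)
  have "continuous (at 0) \<sigma>"
    using assms by (simp add: alg_Hom_def continuous_on_eq_continuous_at)
  then obtain d where d: "d > 0" "\<And>x. dist x 0 < d \<Longrightarrow> dist (\<sigma> x) (\<sigma> 0) < 1"
    unfolding continuous_at_eps_delta by (meson zero_less_one)
  have "norm (\<sigma> x) \<le> norm x * (2 / d)" for x
  proof (cases "x = 0")
    case False
    define r where "r = d / (2 * norm x)"
    have "r > 0" "r * norm x < d" using False d(1) by (simp_all add: r_def)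
    then have "norm (\<sigma> (r *\<^sub>R x)) < 1" using d(2)[of "r *\<^sub>R x"] by (simp add: zero)
    then have "r * norm (\<sigma> x) < 1" using \<open>r > 0\<close> by (simp add: scaleR)
    then show ?thesis using False d(1) by (simp add: r_def field_simps)
  qed (simp add: zero)
  then have "bounded_linear \<sigma>" by (intro bounded_linear_intro add scaleR)
  then show ?thesis by (simp add: cbounded_linear_def scale)
qed

definition sigma_bimodule_hom ::
  "('a::complex_banach_algebra \<Rightarrow> 'a) \<Rightarrow>
   ('a \<Rightarrow> 'x::complex_banach \<Rightarrow> 'x) \<Rightarrow> ('x \<Rightarrow> 'a \<Rightarrow> 'x) \<Rightarrow>
   ('a \<Rightarrow> 'y::complex_banach \<Rightarrow> 'y) \<Rightarrow> ('y \<Rightarrow> 'a \<Rightarrow> 'y) \<Rightarrow> ('x \<Rightarrow> 'y) \<Rightarrow> bool" where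
  "sigma_bimodule_hom \<sigma> lX rX lY rY T \<longleftrightarrow> cbounded_linear T \<and>
     (\<forall>a x. T (lX a x) = lY (\<sigma> a) (T x)) \<and> (\<forall>a x. T (rX x a) = rY (T x) (\<sigma> a))"

definition sigma_biprojective :: "('a::complex_banach_algebra \<Rightarrow> 'a) \<Rightarrow> bool" where
  "sigma_biprojective \<sigma> \<longleftrightarrow>
     (\<exists>\<rho> :: 'a \<Rightarrow> ('a, 'a) ptensor.
        sigma_bimodule_hom \<sigma> (*) (*) ptensor_lact ptensor_ract \<rho> \<and> ptensor_diag \<circ> \<rho> = \<sigma>)"

definition sigma_biflat :: "('a::complex_banach_algebra \<Rightarrow> 'a) \<Rightarrow> bool" where
  "sigma_biflat \<sigma> \<longleftrightarrow>
     (\<exists>\<rho> :: ('a, 'a) ptensor cdual \<Rightarrow> 'a cdual.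
        cbounded_linear \<rho> \<and>
        (\<forall>a f. \<rho> (dual_lact ptensor_ract (\<sigma> a) f) = dual_lact (*) a (\<rho> f)) \<and>
        (\<forall>a f. \<rho> (dual_ract ptensor_lact f (\<sigma> a)) = dual_ract (*) (\<rho> f) a) \<and>
        \<rho> \<circ> cadjoint ptensor_diag = cadjoint \<sigma>)"

end

theory Submission
  imports Defs
begin

text \<open>
  The map witnessing \<open>\<sigma>\<close>-biflatness is the adjoint \<open>\<rho>\<^sup>*\<close> of the map \<open>\<rho>\<close> witnessing
  \<open>\<sigma>\<close>-biprojectivity. Taking adjoints turns \<open>\<rho> (x \<cdot> a) = \<rho> x \<cdot> \<sigma> a\<close> into
  \<open>\<rho>\<^sup>* (\<sigma> a \<cdot> f) = a \<cdot> \<rho>\<^sup>* f\<close>, and the left compatibility of \<open>\<rho>\<close> into the right compatibility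
  of \<open>\<rho>\<^sup>*\<close>, because the actions on a dual are themselves adjoints of the opposite actions.
  Contravariance gives \<open>\<rho>\<^sup>* \<circ> \<pi>\<^sup>* = (\<pi> \<circ> \<rho>)\<^sup>* = \<sigma>\<^sup>*\<close>.
\<close>

lemma cbounded_linear_cadjoint:
  assumes T: "cbounded_linear T"
  shows "cbounded_linear (cadjoint T)"
proof -
  obtain K where K: "0 \<le> K" "\<And>x. norm (T x) \<le> norm x * K"
    using T bounded_linear.nonneg_bounded unfolding cbounded_linear_def by blast
  note apply_simps = cdual_apply_cadjoint[OF T] cdual_apply_add cdual_apply_scaleC
  have add: "cadjoint T (f + g) = cadjoint T f + cadjoint T g" for f g
    by (rule cdual_eqI) (simp add: apply_simps)
  have scale: "cadjoint T (c *\<^sub>C f) = c *\<^sub>C cadjoint T f" for c f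
    by (rule cdual_eqI) (simp add: apply_simps)
  have bound: "norm (cadjoint T f) \<le> norm f * K" for f
  proof (rule norm_cdual_bound)
    fix x
    have "norm (cdual_apply f (T x)) \<le> norm f * norm (T x)" by (rule norm_cdual_apply)
    also have "\<dots> \<le> norm f * (norm x * K)" by (intro mult_left_mono K) simp
    finally show "norm (cdual_apply (cadjoint T f) x) \<le> norm f * K * norm x"
      by (simp add: apply_simps mult_ac)
  qed (simp add: K)
  have "bounded_linear (cadjoint T)"
    by (rule bounded_linear_intro[OF add _ bound]) (simp add: scaleR_scaleC scale)
  then show ?thesis by (simp add: cbounded_linear_def scale)
qed

lemma cadjoint_compose:
  assumes "cbounded_linear S" "cbounded_linear T"
  shows "cadjoint (S \<circ> T) = cadjoint T \<circ> cadjoint S"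
proof -
  have "cbounded_linear (S \<circ> T)"
    using cbounded_linear_compose[OF assms] by (simp add: comp_def)
  then show ?thesis
    by (intro ext cdual_eqI) (simp add: cdual_apply_cadjoint assms)
qed

text \<open>
  The adjoint of a \<open>\<sigma>\<close>-bimodule homomorphism pulls the action of \<open>\<sigma> a\<close> on the dual of the
  target back to the action of \<open>a\<close> on the dual of the source, with the two sides exchanged.
\<close>

lemma cadjoint_sigma_bimodule_hom:
  assumes X: "banach_bimodule lX rX" and Y: "banach_bimodule lY rY"
    and T: "sigma_bimodule_hom \<sigma> lX rX lY rY T"
  shows "cadjoint T (dual_lact rY (\<sigma> a) f) = dual_lact rX a (cadjoint T f)"
    and "cadjoint T (dual_ract lY f (\<sigma> a)) = dual_ract lX (cadjoint T f) a"
proof -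
  have bl: "cbounded_linear T"
    and l: "\<And>a x. T (lX a x) = lY (\<sigma> a) (T x)"
    and r: "\<And>a x. T (rX x a) = rY (T x) (\<sigma> a)"
    using T by (simp_all add: sigma_bimodule_hom_def)
  note apply_simps = cdual_apply_cadjoint[OF bl]
    banach_bimodule.cdual_apply_dual_lact[OF X] banach_bimodule.cdual_apply_dual_lact[OF Y]
    banach_bimodule.cdual_apply_dual_ract[OF X] banach_bimodule.cdual_apply_dual_ract[OF Y]
  show "cadjoint T (dual_lact rY (\<sigma> a) f) = dual_lact rX a (cadjoint T f)"
    by (rule cdual_eqI) (simp add: apply_simps r)
  show "cadjoint T (dual_ract lY f (\<sigma> a)) = dual_ract lX (cadjoint T f) a"
    by (rule cdual_eqI) (simp add: apply_simps l)
qed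

theorem proposition2p4:
  fixes \<sigma> :: "'a::complex_banach_algebra \<Rightarrow> 'a"
  assumes "\<sigma> \<in> alg_Hom"
    and "sigma_biprojective \<sigma>"
  shows "sigma_biflat \<sigma>"
proof -
  obtain \<rho> :: "'a \<Rightarrow> ('a, 'a) ptensor"
    where hom: "sigma_bimodule_hom \<sigma> (*) (*) ptensor_lact ptensor_ract \<rho>"
      and diag: "ptensor_diag \<circ> \<rho> = \<sigma>"
    using assms(2) unfolding sigma_biprojective_def by blast
  have bl: "cbounded_linear \<rho>"
    using hom by (simp add: sigma_bimodule_hom_def)
  have "cadjoint \<rho> \<circ> cadjoint ptensor_diag = cadjoint \<sigma>"
    using cadjoint_compose[OF cbounded_linear_ptensor_diag bl] by (simp only: diag)
  then show ?thesis
    unfolding sigma_biflat_def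
    using cbounded_linear_cadjoint[OF bl]
      cadjoint_sigma_bimodule_hom[OF banach_bimodule_algebra banach_bimodule_ptensor hom]
    by blast
qed

end
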